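(* Let $n\ge 1$. The algebra $\mathrm{DTL}(\mathrm{B}_n)$ has rank $C_n+C_{n+1}-1$, i.e. it is a free $\mathbb{Z}[\delta^{\pm1}]$-module of rank $C_n+C_{n+1}-1$, where $C_k=\frac{1}{k+1}\binom{2k}{k}$ denotes the $k$-th Catalan number.
   Context: All algebras are associative and unital over $\mathbb{Z}[\delta^{\pm 1}]$, where $\delta$ is an invertible indeterminate. $\mathrm{DTL}(\mathrm{B}_n)$ (the Dieck-Temperley-Lieb algebra of type $\mathrm{B}_n$) is the $\mathbb{Z}[\delta^{\pm1}]$-algebra generated by $e_0,e_1,\dots,e_{n-1}$ subject to: $e_0^2=\delta^2 e_0$; $e_i^2=\delta e_i$ for $1\le i\le n-1$; $e_ie_j=e_je_i$ if $|i-j|>1$; $e_ie_je_i=e_i$ if $i,j\ge 1$ and $|i-j|=1$; and $e_0e_1e_0=\delta e_0$. *)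

theory Defs
  imports "HOL-Library.Poly_Mapping" "HOL-Library.FuncSet" "HOL-Algebra.Algebra"
    "HOL-Algebra.Algebraic_Closure_Type"
begin

(* Laurent polynomials with integer coefficients, as the group ring of the additive group of
   the integers: the key of a monomial is its exponent and multiplication is convolution. *)

type_synonym laurent = "int \<Rightarrow>\<^sub>0 int"

definition \<delta> :: laurent where
  "\<delta> = Poly_Mapping.single 1 1"

lemma delta_inverse: "\<delta> * Poly_Mapping.single (- 1) 1 = 1"
  by (simp add: \<delta>_def mult_single)

(* The free monoid on countably many letters. It is a type of its own, written additively (though
   not commutative), because multiplication on poly_mapping requires a monoid_add of keys. *)

datatype word = Word (letters: "nat list")

instantiation word :: monoid_add
begin

definition "0 = Word []"

definition "u + v = Word (letters u @ letters v)"

instance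
  by standard (auto simp: zero_word_def plus_word_def)

end

type_synonym 'r ncpoly = "word \<Rightarrow>\<^sub>0 'r"

definition gen :: "nat \<Rightarrow> 'r::comm_ring_1 ncpoly" where
  "gen i = Poly_Mapping.single (Word [i]) 1"

definition scalar :: "'r::comm_ring_1 \<Rightarrow> 'r ncpoly" where
  "scalar a = Poly_Mapping.single 0 a"

(* The free associative unital algebra on the n letters 0, ..., n - 1. *)

definition free_algebra :: "nat \<Rightarrow> 'r::comm_ring_1 ncpoly ring" where
  "free_algebra n =
     ring_of_type_algebra \<lparr>carrier := {p. \<forall>w \<in> Poly_Mapping.keys p. set (letters w) \<subseteq> {..<n}}\<rparr>"

(* The algebra on n generators presented by the relations r = 0 for r in S: the quotient of the
   free algebra by the two-sided ideal generated by S. A scalar acts as multiplication by its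
   image under the structure map into the quotient. *)

definition presented_algebra ::
    "nat \<Rightarrow> 'r::comm_ring_1 ncpoly set \<Rightarrow> ('r, 'r ncpoly set) module" where
  "presented_algebra n S =
     (let F = free_algebra n; I = Idl\<^bsub>F\<^esub> S; Q = F Quot I
      in ring.extend Q (module.fields (\<lambda>a x. (I +>\<^bsub>F\<^esub> scalar a) \<otimes>\<^bsub>Q\<^esub> x)))"

inductive_set DTLB_relators :: "nat \<Rightarrow> laurent ncpoly set" for n where
  sq0: "0 < n \<Longrightarrow> gen 0 * gen 0 - scalar (\<delta>^2) * gen 0 \<in> DTLB_relators n"
| sq: "1 \<le> i \<Longrightarrow> i < n \<Longrightarrow> gen i * gen i - scalar \<delta> * gen i \<in> DTLB_relators n"
| comm: "i < n \<Longrightarrow> j < n \<Longrightarrow> \<bar>int i - int j\<bar> > 1 \<Longrightarrow>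
    gen i * gen j - gen j * gen i \<in> DTLB_relators n"
| triple: "1 \<le> i \<Longrightarrow> i < n \<Longrightarrow> 1 \<le> j \<Longrightarrow> j < n \<Longrightarrow> \<bar>int i - int j\<bar> = 1 \<Longrightarrow>
    gen i * gen j * gen i - gen i \<in> DTLB_relators n"
| triple0: "1 < n \<Longrightarrow> gen 0 * gen 1 * gen 0 - scalar \<delta> * gen 0 \<in> DTLB_relators n"

definition DTLB :: "nat \<Rightarrow> (laurent, laurent ncpoly set) module" where
  "DTLB n = presented_algebra n (DTLB_relators n)"

definition finite_basis :: "('a, 'm) ring_scheme \<Rightarrow> ('a, 'b, 'k) module_scheme \<Rightarrow> 'b set \<Rightarrow> bool" where
  "finite_basis R M B \<longleftrightarrow>
     finite B \<and> B \<subseteq> carrier M \<and>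
     (\<forall>x \<in> carrier M. \<exists>!c. c \<in> B \<rightarrow>\<^sub>E carrier R \<and> x = (\<Oplus>\<^bsub>M\<^esub>b\<in>B. c b \<odot>\<^bsub>M\<^esub> b))"

definition free_module_of_rank ::
    "('a, 'm) ring_scheme \<Rightarrow> ('a, 'b, 'k) module_scheme \<Rightarrow> nat \<Rightarrow> bool" where
  "free_module_of_rank R M k \<longleftrightarrow> module R M \<and> (\<exists>B. finite_basis R M B \<and> card B = k)"

definition catalan :: "nat \<Rightarrow> nat" where
  "catalan k = (2 * k choose k) div (k + 1)"

(* The division is exact. *)

lemma Suc_mult_catalan: "(k + 1) * catalan k = (2 * k choose k)"
proof -
  have "(k + 1) * (2 * k choose (k + 1)) = k * (2 * k choose k)"
    using binomial_absorb_comp[of "2 * k" k] binomial_absorption[of k "2 * k"]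
    by (simp only: Suc_eq_plus1 mult_2 diff_add_inverse)
  then have "(k + 1) * ((2 * k choose k) - (2 * k choose (k + 1))) = (2 * k choose k)"
    by (simp add: diff_mult_distrib2)
  then have "(k + 1) dvd (2 * k choose k)"
    by (metis dvd_triv_left)
  then show ?thesis
    unfolding catalan_def by (rule dvd_mult_div_cancel)
qed

(* Presented algebras are associative unital algebras. *)

lemma ring_ring_of_type_algebra: "ring (ring_of_type_algebra :: 'a::ring_1 ring)"
proof -
  have "\<exists>y. x + y = 0" "\<exists>y. y + x = 0" for x :: 'a
    by (metis add.right_inverse, metis add.left_inverse)
  then show ?thesis
    unfolding ring_of_type_algebra_def
    by unfold_locales (auto simp: algebra_simps Units_def)
qed

lemma ring_free_algebra: "ring (free_algebra n :: 'r::comm_ring_1 ncpoly ring)"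
proof -
  let ?R = "ring_of_type_algebra :: 'r ncpoly ring"
  let ?C = "{p :: 'r ncpoly. \<forall>w \<in> Poly_Mapping.keys p. set (letters w) \<subseteq> {..<n}}"
  interpret R: ring ?R by (rule ring_ring_of_type_algebra)
  have add: "\<And>x y. x \<oplus>\<^bsub>?R\<^esub> y = x + y" and mult: "\<And>x y. x \<otimes>\<^bsub>?R\<^esub> y = x * y"
    and one: "\<one>\<^bsub>?R\<^esub> = 1" and carr: "carrier ?R = UNIV" and zero: "\<zero>\<^bsub>?R\<^esub> = 0"
    by (simp_all add: ring_of_type_algebra_def)
  have neg: "\<ominus>\<^bsub>?R\<^esub> x = - x" for x
    by (rule R.minus_equality) (simp_all add: add carr zero)
  have "subring ?C ?R"
  proof (rule R.subringI)
    show "?C \<subseteq> carrier ?R" by (simp add: carr)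
    show "\<one>\<^bsub>?R\<^esub> \<in> ?C"
      by (simp add: one zero_word_def)
  next
    fix p assume "p \<in> ?C" then show "\<ominus>\<^bsub>?R\<^esub> p \<in> ?C" by (simp add: neg)
  next
    fix p q assume pq: "p \<in> ?C" "q \<in> ?C"
    show "p \<oplus>\<^bsub>?R\<^esub> q \<in> ?C"
      using pq keys_add[of p q] by (auto simp: add)
    have "set (letters w) \<subseteq> {..<n}" if w: "w \<in> Poly_Mapping.keys (p * q)" for w
    proof -
      obtain u v where "w = u + v" "u \<in> Poly_Mapping.keys p" "v \<in> Poly_Mapping.keys q"
        using w keys_mult[of p q] by blast
      with pq show ?thesis by (simp add: plus_word_def)
    qed
    then show "p \<otimes>\<^bsub>?R\<^esub> q \<in> ?C" by (simp add: mult)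
  qed
  then show ?thesis
    unfolding free_algebra_def by (rule R.subring_is_ring)
qed

lemma free_algebra_simps:
  "x \<oplus>\<^bsub>free_algebra n\<^esub> y = x + y" "x \<otimes>\<^bsub>free_algebra n\<^esub> y = x * y"
  "\<zero>\<^bsub>free_algebra n\<^esub> = 0" "\<one>\<^bsub>free_algebra n\<^esub> = 1"
  by (simp_all add: free_algebra_def ring_of_type_algebra_def)

lemma scalar_in_free_algebra: "scalar a \<in> carrier (free_algebra n)"
  by (simp add: free_algebra_def scalar_def zero_word_def)

lemma scalar_central: "scalar a * p = p * scalar a"
proof (induction p rule: update_induct)
  case const
  show ?case by simp
next
  case (update p w b)
  have "Poly_Mapping.update w b p = p + Poly_Mapping.single w b"
    using update.hyps
    by (intro poly_mapping_eqI) (auto simp: lookup_update lookup_add lookup_single when_def in_keys_iff)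
  with update.IH show ?case
    by (simp add: distrib_left distrib_right scalar_def mult_single mult.commute)
qed

lemma presented_algebra_simps:
  fixes n :: nat and S :: "'r::comm_ring_1 ncpoly set"
  defines "F \<equiv> free_algebra n"
  shows "carrier (presented_algebra n S) = carrier (F Quot Idl\<^bsub>F\<^esub> S)"
    and "x \<oplus>\<^bsub>presented_algebra n S\<^esub> y = x \<oplus>\<^bsub>F Quot Idl\<^bsub>F\<^esub> S\<^esub> y"
    and "x \<otimes>\<^bsub>presented_algebra n S\<^esub> y = x \<otimes>\<^bsub>F Quot Idl\<^bsub>F\<^esub> S\<^esub> y"
    and "\<zero>\<^bsub>presented_algebra n S\<^esub> = \<zero>\<^bsub>F Quot Idl\<^bsub>F\<^esub> S\<^esub>"
    and "\<one>\<^bsub>presented_algebra n S\<^esub> = \<one>\<^bsub>F Quot Idl\<^bsub>F\<^esub> S\<^esub>"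
    and "a \<odot>\<^bsub>presented_algebra n S\<^esub> x
           = (Idl\<^bsub>F\<^esub> S +>\<^bsub>F\<^esub> scalar a) \<otimes>\<^bsub>F Quot Idl\<^bsub>F\<^esub> S\<^esub> x"
  by (simp_all add: presented_algebra_def F_def Let_def ring.defs module.defs)

lemma
  fixes S :: "'r::comm_ring_1 ncpoly set"
  assumes S: "S \<subseteq> carrier (free_algebra n)"
  shows ring_presented_algebra: "ring (presented_algebra n S)"
    and module_presented_algebra:
      "module (ring_of_type_algebra :: 'r ring) (presented_algebra n S)"
    and smult_mult_presented_algebra:
      "\<lbrakk>x \<in> carrier (presented_algebra n S); y \<in> carrier (presented_algebra n S)\<rbrakk> \<Longrightarrow>
        (a \<odot>\<^bsub>presented_algebra n S\<^esub> x) \<otimes>\<^bsub>presented_algebra n S\<^esub> y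
          = a \<odot>\<^bsub>presented_algebra n S\<^esub> (x \<otimes>\<^bsub>presented_algebra n S\<^esub> y)"
      "\<lbrakk>x \<in> carrier (presented_algebra n S); y \<in> carrier (presented_algebra n S)\<rbrakk> \<Longrightarrow>
        x \<otimes>\<^bsub>presented_algebra n S\<^esub> (a \<odot>\<^bsub>presented_algebra n S\<^esub> y)
          = a \<odot>\<^bsub>presented_algebra n S\<^esub> (x \<otimes>\<^bsub>presented_algebra n S\<^esub> y)"
proof -
  define F :: "'r ncpoly ring" where "F = free_algebra n"
  define I where "I = Idl\<^bsub>F\<^esub> S"
  define Q where "Q = F Quot I"
  define h where "h = (\<lambda>a :: 'r. I +>\<^bsub>F\<^esub> scalar a)"
  interpret F: ring F unfolding F_def by (rule ring_free_algebra)
  interpret I: ideal I F unfolding I_def using S by (intro F.genideal_ideal) (simp add: F_def)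
  interpret Q: ring Q unfolding Q_def by (rule I.quotient_is_ring)
  have hom: "(+>\<^bsub>F\<^esub>) I \<in> ring_hom F Q"
    unfolding Q_def by (rule I.rcos_ring_hom)
  have sc: "scalar a \<in> carrier F" for a
    by (simp add: F_def scalar_in_free_algebra)
  have h_closed: "h a \<in> carrier Q" for a
    unfolding h_def by (rule ring_hom_closed[OF hom sc])
  have h_add: "h (a + b) = h a \<oplus>\<^bsub>Q\<^esub> h b" for a b
    unfolding h_def ring_hom_add[OF hom sc sc, symmetric]
    by (simp add: F_def free_algebra_simps scalar_def single_add)
  have h_mult: "h (a * b) = h a \<otimes>\<^bsub>Q\<^esub> h b" for a b
    unfolding h_def ring_hom_mult[OF hom sc sc, symmetric]
    by (simp add: F_def free_algebra_simps scalar_def mult_single)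
  have h_one: "h 1 = \<one>\<^bsub>Q\<^esub>"
    unfolding h_def ring_hom_one[OF hom, symmetric]
    by (simp add: F_def free_algebra_simps scalar_def)
  have h_central: "h a \<otimes>\<^bsub>Q\<^esub> x = x \<otimes>\<^bsub>Q\<^esub> h a" if x: "x \<in> carrier Q" for a x
  proof -
    obtain p where p: "p \<in> carrier F" "x = I +>\<^bsub>F\<^esub> p"
      using x by (auto simp: Q_def FactRing_def A_RCOSETS_def')
    show ?thesis
      unfolding p(2) h_def ring_hom_mult[OF hom sc p(1), symmetric]
        ring_hom_mult[OF hom p(1) sc, symmetric]
      by (simp add: F_def free_algebra_simps scalar_central)
  qed
  note simps = presented_algebra_simps[of n S, folded F_def, folded I_def, folded Q_def]
  have smult: "a \<odot>\<^bsub>presented_algebra n S\<^esub> x = h a \<otimes>\<^bsub>Q\<^esub> x" for a x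
    by (simp add: simps h_def)
  note simps = simps(1-5) smult
  let ?M = "presented_algebra n S"
  have ab: "abelian_group ?M"
    using Q.a_inv_closed Q.r_neg Q.l_neg
    by (intro abelian_groupI) (auto simp: simps Q.a_ac)
  show "ring ?M"
    using ab by (intro ringI) (auto intro!: monoidI simp: simps Q.m_assoc Q.l_distr Q.r_distr)
  show "module (ring_of_type_algebra :: 'r ring) ?M"
    by (intro moduleI ab cring_from_type_algebra)
      (simp_all add: simps ring_of_type_algebra_def h_closed h_add h_mult h_one
        Q.l_distr Q.r_distr Q.m_assoc)
  show "(a \<odot>\<^bsub>?M\<^esub> x) \<otimes>\<^bsub>?M\<^esub> y = a \<odot>\<^bsub>?M\<^esub> (x \<otimes>\<^bsub>?M\<^esub> y)"
    if "x \<in> carrier ?M" "y \<in> carrier ?M"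
    using that by (simp add: simps h_closed Q.m_assoc)
  show "x \<otimes>\<^bsub>?M\<^esub> (a \<odot>\<^bsub>?M\<^esub> y) = a \<odot>\<^bsub>?M\<^esub> (x \<otimes>\<^bsub>?M\<^esub> y)"
    if "x \<in> carrier ?M" "y \<in> carrier ?M"
    using that by (simp add: simps) (metis Q.m_assoc h_central h_closed)
qed

lemma gen_in_free_algebra: "i < n \<Longrightarrow> gen i \<in> carrier (free_algebra n)"
  by (simp add: free_algebra_def gen_def)

lemma DTLB_relators_subset: "DTLB_relators n \<subseteq> carrier (free_algebra n)"
proof -
  interpret ring "free_algebra n :: laurent ncpoly ring" by (rule ring_free_algebra)
  have diff: "p - q \<in> carrier (free_algebra n)"
    if "p \<in> carrier (free_algebra n)" "q \<in> carrier (free_algebra n)" for p q :: "laurent ncpoly"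
    using that keys_diff[of p q] by (auto simp: free_algebra_def)
  have mult: "p * q \<in> carrier (free_algebra n)"
    if "p \<in> carrier (free_algebra n)" "q \<in> carrier (free_algebra n)" for p q :: "laurent ncpoly"
    using m_closed[OF that] by (simp add: free_algebra_simps)
  show ?thesis
    by (auto elim!: DTLB_relators.cases
        intro!: diff mult gen_in_free_algebra scalar_in_free_algebra)
qed

end

(* Every relation equates a monomial with a power of \<delta> times a monomial, so the algebra has a basis of
   monomials once it is known that no two chosen representatives become proportional.

   Words without the letter 0 generate a Temperley-Lieb algebra on n strands. For words containing 0
   put z_0 = \<delta>^-1 e_0 and z_(i+1) = e_(i+1) z_i e_(i+1). The key point is that e_i acts on the ideal
   generated by e_0 as z_i does, which comes down to e_1 e_0 e_1 u e_0 = \<delta> e_1 u e_0 for every word u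
   without 0. Hence z_0, ..., z_(n-1) satisfy the relations of the Temperley-Lieb algebra on n + 1
   strands, and a word containing 0 is a power of \<delta> times the same nonempty word in the z_i. Jones'
   normal form bounds the number of classes by C_n + (C_(n+1) - 1). Conversely, e_0 \<mapsto> \<delta> E_0 and
   e_i \<mapsto> E_i defines a map to the Temperley-Lieb algebra on n + 1 strands; the diagram of a word, together
   with the occurrence of 0 in it, separates the normal forms. *)

theory Submission
  imports Defs
begin

section \<open>Jones normal form\<close>

text \<open>Words are treated as operators rather than as elements: \<open>foldr E w\<close> acts on
  a bare set and \<open>T k\<close> stands for multiplication by \<open>\<delta>^k\<close>. Nothing
  is lost, since each side of a relation is a single term, and one normal form theorem then serves
  both the letters 1, ..., n - 1 and the z_i. Left-right symmetry also comes cheaply, because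
  precomposition is again such an action.

  The identity e_1 e_0 e_1 u e_0 = \<delta> e_1 u e_0 holds for arbitrary u only because u can first
  be put into normal form. There the letter 1 can occur only in the first block, so e_1 u equals v
  e_1 w up to a power of \<delta>, with v in letters >= 3 and w in letters >= 2. Now w commutes with
  e_0, v commutes with e_0 and e_1, and e_0 e_1 e_0 = \<delta> e_0 finishes.

  The occurrence of 0 must be recorded beside the diagram because e_1 and z_1 are sent to the same
  element of the Temperley-Lieb algebra.\<close>

definition descent :: "nat \<Rightarrow> nat \<Rightarrow> nat list" where
  "descent i j = rev [j..<Suc i]"

text \<open>A pair \<open>(i, j)\<close> stands for the block \<open>i, i - 1, \<dots>, j\<close> of Jones' normal form.\<close>

fun jones :: "(nat \<times> nat) list \<Rightarrow> bool" where
  "jones [] = True"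
| "jones ((i, j) # bs) = (j \<le> i \<and> (\<forall>(i', j') \<in> set bs. i < i' \<and> j < j') \<and> jones bs)"

definition jword :: "(nat \<times> nat) list \<Rightarrow> nat list" where
  "jword bs = concat (map (\<lambda>(i, j). descent i j) bs)"

lemma jword_simps [simp]:
  "jword [] = []" "jword ((i, j) # bs) = descent i j @ jword bs"
  by (simp_all add: jword_def)

lemma set_descent [simp]: "set (descent i j) = {j..i}"
  by (auto simp: descent_def)

lemma descent_rec: "j \<le> i \<Longrightarrow> descent (Suc i) j = Suc i # descent i j"
  by (simp add: descent_def)

lemma descent_same [simp]: "descent i i = [i]"
  by (simp add: descent_def)

lemma descent_eq_Nil [simp]: "descent i j = [] \<longleftrightarrow> i < j"
  by (auto simp: descent_def)

lemma descent_append: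
  assumes "j \<le> k" "k \<le> i" shows "descent i j = descent i (Suc k) @ descent k j"
proof -
  have "[j..<Suc i] = [j..<Suc k] @ [Suc k..<Suc i]"
    using assms by (metis le_SucI le_add_diff_inverse not_less_eq_eq upt_add_eq_append)
  then show ?thesis by (simp add: descent_def del: upt_Suc)
qed

lemma descent_Cons: "j \<le> i \<Longrightarrow> descent i j = i # rev [j..<i]"
  by (simp add: descent_def)

lemma descent_snoc: "j \<le> i \<Longrightarrow> descent i j = descent i (Suc j) @ [j]"
  using descent_append[of j j i] by simp

text \<open>The Temperley-Lieb relations read from left to right, with powers of \<delta> dropped.
  \<open>fall\<close> and \<open>rise\<close> are the two cubic relations with commuting letters in
  between, so that every obstruction met when a letter is put before a Jones word is a contiguous
  factor.\<close>

inductive redex :: "nat list \<Rightarrow> nat list \<Rightarrow> bool" where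
  swap: "Suc b < a \<Longrightarrow> redex [a, b] [b, a]"
| square: "redex [a, a] [a]"
| fall: "c \<le> a \<Longrightarrow> redex (descent (Suc a) c @ [Suc a]) (Suc a # rev [c..<a])"
| rise: "a < b \<Longrightarrow> redex (a # descent b a) (descent b (a + 2) @ [a])"

text \<open>Only the position of the new letter \<open>a\<close> relative to the first block
  \<open>(i, j)\<close> of the tail matters: \<open>a\<close> equal to \<open>i\<close> gives
  \<open>square\<close>, above \<open>i + 1\<close> gives \<open>swap\<close>, inside the block
  gives \<open>rise\<close>, and below \<open>j\<close> starts a new block. For
  \<open>a = i + 1\<close> the block grows, unless the next block also has top \<open>a\<close>,
  which gives \<open>fall\<close>.\<close>

lemma jones_or_redex:
  "(\<exists>bs. jones bs \<and> w = jword bs) \<or> (\<exists>u p q v. w = u @ p @ v \<and> redex p q)"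
proof (induction w)
  case Nil
  have "jones []" "[] = jword []" by simp_all
  then show ?case by blast
next
  case (Cons a w)
  show ?case
  proof (cases "\<exists>u p q v. w = u @ p @ v \<and> redex p q")
    case True
    then show ?thesis by (metis append_Cons)
  next
    case False
    with Cons obtain bs where bs: "jones bs" "w = jword bs" by blast
    show ?thesis
    proof (cases bs)
      case Nil
      then have "jones [(a, a)]" "a # w = jword [(a, a)]" using bs by simp_all
      then show ?thesis by blast
    next
      case (Cons b bs')
      obtain i j where b: "b = (i, j)" by force
      have w: "w = descent i j @ jword bs'" and ji: "j \<le> i"
        and lt: "\<And>i' j'. (i', j') \<in> set bs' \<Longrightarrow> i < i' \<and> j < j'" and bs': "jones bs'"
        using bs Cons b by auto
      consider "a = i" | "Suc i < a" | "a = Suc i" | "a < j" | "j \<le> a" "a < i" by linarith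
      then show ?thesis
      proof cases
        case 1
        then have "a # w = [] @ [a, a] @ (rev [j..<i] @ jword bs')"
          using ji by (simp add: w descent_Cons)
        then show ?thesis using square by blast
      next
        case 2
        have "a # w = [] @ [a, i] @ (rev [j..<i] @ jword bs')"
          using ji by (simp add: w descent_Cons)
        then show ?thesis using swap[OF 2] by blast
      next
        case 3
        show ?thesis
        proof (cases "\<exists>j' cs. bs' = (a, j') # cs")
          case True
          then obtain j' cs where cs: "bs' = (a, j') # cs" by blast
          with bs' have "j' \<le> a" by auto
          then have "a # w = [] @ (descent (Suc i) j @ [Suc i]) @ (rev [j'..<a] @ jword cs)"
            using 3 ji cs by (simp add: w descent_rec descent_Cons[of j' "Suc i"])
          then show ?thesis using fall[OF ji] by blast
        next
          case False
          \<comment> \<open>Tops increase strictly, so excluding \<open>Suc i\<close> as the top of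
            the next block excludes it for all later ones; the enlarged block is then
            admissible.\<close>
          have "Suc i < i'" if m: "(i', j') \<in> set bs'" for i' j'
          proof (cases bs')
            case Nil then show ?thesis using m by simp
          next
            case (Cons c cs)
            obtain i1 j1 where c: "c = (i1, j1)" by force
            have "i < i1" using lt Cons c by auto
            moreover have "i1 \<noteq> Suc i" using False 3 Cons c by blast
            moreover have "i1 \<le> i'" using bs' m Cons c by auto
            ultimately show ?thesis by linarith
          qed
          then have "jones ((a, j) # bs')" using 3 ji lt bs' by auto
          moreover have "a # w = jword ((a, j) # bs')" using 3 ji by (simp add: w descent_rec)
          ultimately show ?thesis by blast
        qed
      next
        case 4
        then have "jones ((a, a) # (i, j) # bs')" using ji lt bs' by fastforce
        moreover have "a # w = jword ((a, a) # (i, j) # bs')" by (simp add: w)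
        ultimately show ?thesis by blast
      next
        case 5
        have "a # w = [] @ (a # descent i a) @ (rev [j..<a] @ jword bs')"
        proof (cases a)
          case 0
          then show ?thesis using 5 by (simp add: w)
        next
          case (Suc a')
          show ?thesis
          proof (cases "j = a")
            case True
            then show ?thesis by (simp add: w)
          next
            case False
            then have "j \<le> a'" using 5 Suc by simp
            then show ?thesis
              using 5 Suc descent_append[of j a' i] by (simp add: w descent_def del: upt_Suc)
          qed
        qed
        then show ?thesis using rise[OF 5(2)] by blast
      qed
    qed
  qed
qed

text \<open>Each letter is weighted by the length of the suffix it starts. This decreases when
  \<open>swap\<close> moves the larger letter to the right, the one rule that preserves
  length.\<close>

primrec weight :: "nat list \<Rightarrow> nat" where
  "weight [] = 0"
| "weight (a # w) = a * Suc (length w) + weight w"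

lemma weight_append: "weight (u @ v) = weight u + sum_list u * length v + weight v"
  by (induction u) (auto simp: algebra_simps)

lemma redex_measure: "redex p q \<Longrightarrow> (u @ q @ v, u @ p @ v) \<in> measures [length, weight]"
proof (induction rule: redex.induct)
  case (rise a b)
  then have "length (descent b (a + 2) @ [a]) < length (a # descent b a)"
    by (auto simp: descent_def)
  then show ?case by simp
next
  case (fall c a)
  then show ?case by (simp add: descent_def)
qed (auto simp: weight_append algebra_simps)

lemma redex_set: "redex p q \<Longrightarrow> set q \<subseteq> set p"
  by (induction rule: redex.induct) auto

lemma redex_nonempty: "redex p q \<Longrightarrow> q \<noteq> []"
  by (induction rule: redex.induct) auto

text \<open>\<open>T k\<close> plays the role of multiplication by \<open>\<delta>\<^sup>k\<close>.\<close>

locale scaled_action =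
  fixes T :: "int \<Rightarrow> 'a \<Rightarrow> 'a" and E :: "nat \<Rightarrow> 'a \<Rightarrow> 'a" and A :: "nat set"
  assumes T_0 [simp]: "T 0 x = x"
    and T_T [simp]: "T k (T l x) = T (k + l) x"
    and E_T: "i \<in> A \<Longrightarrow> E i (T k x) = T k (E i x)"
begin

lemma foldr_T: "set w \<subseteq> A \<Longrightarrow> foldr E w (T k x) = T k (foldr E w x)"
  by (induction w) (auto simp: E_T)

end

text \<open>No linear structure is assumed, and the index set \<open>A\<close> is free: it will be
  \<open>{1..<n}\<close> for the original letters and \<open>{..<n}\<close> for the operators
  z_i.\<close>

locale TL_action = scaled_action +
  assumes sq: "i \<in> A \<Longrightarrow> E i (E i x) = T 1 (E i x)"
    and comm: "i \<in> A \<Longrightarrow> j \<in> A \<Longrightarrow> Suc i < j \<Longrightarrow> E i (E j x) = E j (E i x)"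
    and triple_up: "i \<in> A \<Longrightarrow> Suc i \<in> A \<Longrightarrow> E i (E (Suc i) (E i x)) = E i x"
    and triple_down: "i \<in> A \<Longrightarrow> Suc i \<in> A \<Longrightarrow> E (Suc i) (E i (E (Suc i) x)) = E (Suc i) x"
begin

lemma foldr_comm:
  assumes "a \<in> A" "set w \<subseteq> A" "\<And>b. b \<in> set w \<Longrightarrow> Suc a < b \<or> Suc b < a"
  shows "E a (foldr E w x) = foldr E w (E a x)"
  using assms(2,3)
proof (induction w)
  case (Cons b w)
  then have "b \<in> A" "Suc a < b \<or> Suc b < a" by auto
  then have "E a (E b y) = E b (E a y)" for y
    using comm[of a b] comm[of b a] assms(1) by metis
  with Cons show ?case by simp
qed simp

text \<open>In \<open>fall\<close> the final letter, and in \<open>rise\<close> the initial one,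
  commutes past the far letters until a cubic relation applies. The exponent is chosen before
  \<open>x\<close>, so this is an equality of operators and can be used inside a longer
  word.\<close>

lemma redex_foldr:
  assumes "redex p q" "set p \<subseteq> A"
  shows "\<exists>k. \<forall>x. foldr E p x = T k (foldr E q x)"
  using assms
proof (induction rule: redex.induct)
  case (swap b a)
  then have "foldr E [a, b] x = T 0 (foldr E [b, a] x)" for x
    using comm[of b a] by auto
  then show ?case by blast
next
  case (square a)
  then have "foldr E [a, a] x = T 1 (foldr E [a] x)" for x
    using sq[of a] by auto
  then show ?case by blast
next
  case (fall c a)
  then have A: "{c..Suc a} \<subseteq> A" by auto
  have "foldr E (descent (Suc a) c @ [Suc a]) x = T 0 (foldr E (Suc a # rev [c..<a]) x)" for x
  proof -
    have "set (rev [c..<a]) \<subseteq> A" using A by auto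
    then have "foldr E (rev [c..<a]) (E (Suc a) x) = E (Suc a) (foldr E (rev [c..<a]) x)"
      using A fall by (intro foldr_comm[symmetric]) auto
    moreover have "a \<in> A" "Suc a \<in> A" using A fall by auto
    ultimately show ?thesis
      using fall(1) by (simp add: descent_rec descent_Cons triple_down)
  qed
  then show ?case by blast
next
  case (rise a b)
  then have A: "{a..b} \<subseteq> A" by auto
  have "foldr E (a # descent b a) x = T 0 (foldr E (descent b (a + 2) @ [a]) x)" for x
  proof -
    have d: "descent b a = descent b (a + 2) @ [Suc a, a]"
      using rise(1) descent_snoc[of a b] descent_snoc[of "Suc a" b] by simp
    have "set (descent b (a + 2)) \<subseteq> A" using A by auto
    then have "E a (foldr E (descent b (a + 2)) y) = foldr E (descent b (a + 2)) (E a y)" for y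
      using A rise by (intro foldr_comm) auto
    moreover have "a \<in> A" "Suc a \<in> A" using A rise(1) by auto
    ultimately show ?thesis by (simp add: d triple_up)
  qed
  then show ?case by blast
qed

text \<open>Well-founded rewriting with the redexes. That nonempty words keep a nonempty normal form
  is recorded because the empty word in the z_i must be excluded later.\<close>

theorem foldr_eq_jones:
  assumes "set w \<subseteq> A"
  obtains k bs where "jones bs" "set (jword bs) \<subseteq> set w" "w = [] \<longleftrightarrow> bs = []"
    "\<And>x. foldr E w x = T k (foldr E (jword bs) x)"
proof -
  have "\<exists>k bs. jones bs \<and> set (jword bs) \<subseteq> set w \<and> (w = [] \<longleftrightarrow> bs = []) \<and>
      (\<forall>x. foldr E w x = T k (foldr E (jword bs) x))"
    using assms
  proof (induction w rule: wf_induct_rule[OF wf_measures[of "[length, weight]"]])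
    case (1 w)
    show ?case
    proof (cases "\<exists>bs. jones bs \<and> w = jword bs")
      case True
      then obtain bs where bs: "jones bs" "w = jword bs" by blast
      then have "w = [] \<longleftrightarrow> bs = []"
        by (cases bs) auto
      with bs have "jones bs \<and> set (jword bs) \<subseteq> set w \<and> (w = [] \<longleftrightarrow> bs = []) \<and>
          (\<forall>x. foldr E w x = T 0 (foldr E (jword bs) x))"
        by simp
      then show ?thesis by blast
    next
      case False
      then obtain u p q v where w: "w = u @ p @ v" and r: "redex p q"
        using jones_or_redex by blast
      obtain l where l: "\<And>x. foldr E p x = T l (foldr E q x)"
        using redex_foldr[OF r] 1(2) w by auto
      have "set (u @ q @ v) \<subseteq> set w" using redex_set[OF r] w by auto
      moreover obtain k bs where bs: "jones bs" "set (jword bs) \<subseteq> set (u @ q @ v)"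
        "u @ q @ v = [] \<longleftrightarrow> bs = []"
        "\<And>x. foldr E (u @ q @ v) x = T k (foldr E (jword bs) x)"
        using 1(1)[of "u @ q @ v"] redex_measure[OF r, of u v] w calculation 1(2) by blast
      moreover have "p \<noteq> []" "q \<noteq> []"
        using r redex_nonempty[OF r] by (auto elim: redex.cases)
      moreover have "foldr E w x = T (l + k) (foldr E (jword bs) x)" for x
        using bs(4)[of x] 1(2) by (simp add: w l foldr_T)
      ultimately have "jones bs \<and> set (jword bs) \<subseteq> set w \<and> (w = [] \<longleftrightarrow> bs = []) \<and>
          (\<forall>x. foldr E w x = T (l + k) (foldr E (jword bs) x))"
        using w by auto
      then show ?thesis by blast
    qed
  qed
  then show thesis using that by blast
qed

end

section \<open>Temperley-Lieb diagrams\<close>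

text \<open>
  A Temperley-Lieb diagram is encoded by the fixed-point-free involution that matches its end points.
  The top points are \<open>0, 1, \<dots>\<close>, and \<open>- r - 1\<close> is the bottom point below the top point \<open>r\<close>. The
  number of strands is irrelevant, and planarity is never used.
\<close>

definition matching :: "(int \<Rightarrow> int) \<Rightarrow> bool" where
  "matching \<mu> \<longleftrightarrow> (\<forall>x. \<mu> (\<mu> x) = x \<and> \<mu> x \<noteq> x)"

text \<open>The diagram of E_i stacked on top of \<open>\<mu>\<close>: the new top points i and i +
  1 are joined, and the old partners of i and i + 1 are joined to each other. A closed loop is
  discarded here and counted by \<open>loop\<close>.\<close>

definition cup :: "nat \<Rightarrow> (int \<Rightarrow> int) \<Rightarrow> int \<Rightarrow> int" where
  "cup i \<mu> = (\<lambda>x. if x = int i then int i + 1 else if x = int i + 1 then int i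
     else if \<mu> x = int i then \<mu> (int i + 1) else if \<mu> x = int i + 1 then \<mu> (int i) else \<mu> x)"

definition idm :: "int \<Rightarrow> int" where
  "idm x = - x - 1"

abbreviation diagram :: "nat list \<Rightarrow> int \<Rightarrow> int" where
  "diagram w \<equiv> foldr cup w idm"

lemma matching_idm: "matching idm"
  unfolding matching_def idm_def by presburger

lemma matching_cup: "matching \<mu> \<Longrightarrow> matching (cup i \<mu>)"
  unfolding matching_def cup_def by (smt (verit))

lemma matching_foldr: "matching \<mu> \<Longrightarrow> matching (foldr cup w \<mu>)"
  by (induction w) (auto intro: matching_cup)

text \<open>The exponent of \<delta> released when E_i is stacked on \<open>\<mu>\<close>: a loop
  closes exactly when i and i + 1 are already joined.\<close>

definition loop :: "nat \<Rightarrow> (int \<Rightarrow> int) \<Rightarrow> int" where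
  "loop i \<mu> = (if \<mu> (int i) = int i + 1 then 1 else 0)"

lemma cup_sq: "matching \<mu> \<Longrightarrow> cup i (cup i \<mu>) = cup i \<mu>"
  unfolding matching_def cup_def by (rule ext) (smt (verit))

lemma cup_comm:
  assumes "matching \<mu>" "Suc i < j"
  shows "cup i (cup j \<mu>) = cup j (cup i \<mu>)"
proof
  fix x
  define a b c d where "a = int i" and "b = int j" and "c = int i + 1" and "d = int j + 1"
  have "a \<noteq> b" "a \<noteq> c" "a \<noteq> d" "b \<noteq> c" "b \<noteq> d" "c \<noteq> d"
    using assms(2) by (auto simp: a_def b_def c_def d_def)
  moreover have m: "\<mu> (\<mu> y) = y" "\<mu> y \<noteq> y" for y using assms(1) by (auto simp: matching_def)
  ultimately show "cup i (cup j \<mu>) x = cup j (cup i \<mu>) x"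
    using m[of x] m[of a] m[of b] m[of c] m[of d]
    unfolding cup_def a_def[symmetric] b_def[symmetric]
    unfolding c_def[folded a_def, symmetric] d_def[folded b_def, symmetric]
    by (smt (verit))
qed

text \<open>A cap joining i and i + 1 is slid one place to the right, so i inherits the old partner
  of i + 2. This form keeps the case analysis for the cubic relations small.\<close>

lemma cup_at_cap:
  assumes "matching \<mu>" "\<mu> (int i) = int i + 1"
  shows "cup (Suc i) \<mu> x = (if x = int i + 1 then int i + 2 else if x = int i + 2 then int i + 1
    else if x = int i then \<mu> (int i + 2) else if \<mu> x = int i + 2 then int i else \<mu> x)"
proof -
  have "\<mu> (\<mu> y) = y" for y using assms by (auto simp: matching_def)
  from this[of x] this[of "int i"] show ?thesis using assms(2) by (auto simp: cup_def algebra_simps)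
qed

lemma cup_at_cap':
  assumes "matching \<mu>" "\<mu> (int i + 1) = int i + 2"
  shows "cup i \<mu> x = (if x = int i then int i + 1 else if x = int i + 1 then int i
    else if x = int i + 2 then \<mu> (int i) else if \<mu> x = int i then int i + 2 else \<mu> x)"
proof -
  have "\<mu> (\<mu> y) = y" for y using assms by (auto simp: matching_def)
  from this[of x] this[of "int i + 1"] show ?thesis using assms(2) by (auto simp: cup_def algebra_simps)
qed

lemma cup_up:
  assumes "matching \<mu>"
  shows "cup i (cup (Suc i) (cup i \<mu>)) = cup i \<mu>"
proof
  fix x
  define \<nu> where "\<nu> = cup i \<mu>"
  have \<nu>: "matching \<nu>" unfolding \<nu>_def using assms by (rule matching_cup)
  have cap: "\<nu> (int i) = int i + 1" by (simp add: \<nu>_def cup_def)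
  have m: "\<nu> (\<nu> y) = y" "\<nu> y \<noteq> y" for y using \<nu> by (auto simp: matching_def)
  show "cup i (cup (Suc i) (cup i \<mu>)) x = cup i \<mu> x"
    unfolding \<nu>_def[symmetric] cup_def[of i "cup (Suc i) \<nu>"] cup_at_cap[OF \<nu> cap]
    using m[of x] m[of "int i"] m[of "int i + 2"] cap by auto
qed

lemma cup_down:
  assumes "matching \<mu>"
  shows "cup (Suc i) (cup i (cup (Suc i) \<mu>)) = cup (Suc i) \<mu>"
proof
  fix x
  define \<nu> where "\<nu> = cup (Suc i) \<mu>"
  have \<nu>: "matching \<nu>" unfolding \<nu>_def using assms by (rule matching_cup)
  have cap: "\<nu> (int i + 1) = int i + 2" by (simp add: \<nu>_def cup_def)
  have m: "\<nu> (\<nu> y) = y" "\<nu> y \<noteq> y" for y using \<nu> by (auto simp: matching_def)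
  show "cup (Suc i) (cup i (cup (Suc i) \<mu>)) x = cup (Suc i) \<mu> x"
    unfolding \<nu>_def[symmetric] cup_def[of "Suc i" "cup i \<nu>"] cup_at_cap'[OF \<nu> cap]
    using m[of x] m[of "int i"] m[of "int i + 1"] cap by (auto simp: add.commute)
qed

lemma loop_sq: "loop i (cup i \<mu>) = 1"
  by (simp add: loop_def cup_def)

text \<open>Only the total is independent of the order: if \<open>\<mu>\<close> joins {i, i + 1} to
  {j, j + 1}, the loop closes at the second step whichever generator is applied first.\<close>

lemma loop_comm:
  assumes "matching \<mu>" "Suc i < j"
  shows "loop i (cup j \<mu>) + loop j \<mu> = loop j (cup i \<mu>) + loop i \<mu>"
proof -
  define a b c d where "a = int i" and "b = int j" and "c = int i + 1" and "d = int j + 1"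
  have ne: "a \<noteq> b" "a \<noteq> c" "a \<noteq> d" "b \<noteq> c" "b \<noteq> d" "c \<noteq> d"
    using assms(2) by (auto simp: a_def b_def c_def d_def)
  have m: "\<mu> (\<mu> y) = y" for y using assms(1) by (auto simp: matching_def)
  have inv: "\<mu> y = z \<longleftrightarrow> \<mu> z = y" for y z by (metis m)
  have "(if (if \<mu> a = b then \<mu> d else if \<mu> a = d then \<mu> b else \<mu> a) = c then 1 else 0)
      + (if \<mu> b = d then 1 else 0)
    = (if (if \<mu> b = a then \<mu> c else if \<mu> b = c then \<mu> a else \<mu> b) = d then 1 else 0)
      + (if \<mu> a = c then 1 else (0 :: int))"
    using ne inv[of a b] inv[of a d] inv[of c b] inv[of c d] inv[of a c] inv[of b d]
    by (smt (verit))
  then show ?thesis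
    using ne
    unfolding loop_def cup_def a_def[symmetric] b_def[symmetric]
    unfolding c_def[folded a_def, symmetric] d_def[folded b_def, symmetric]
    by simp
qed

lemma loop_up: "matching \<mu> \<Longrightarrow> loop (Suc i) (cup i \<mu>) = 0"
  unfolding matching_def loop_def cup_def by (smt (verit) of_nat_Suc)

lemma loop_down:
  assumes "matching \<mu>" shows "loop i (cup (Suc i) \<mu>) = 0"
proof -
  have m: "\<mu> (\<mu> y) = y" "\<mu> y \<noteq> y" for y using assms by (auto simp: matching_def)
  show ?thesis
    using m[of "int i"] m[of "int i + 1"] m[of "int i + 2"]
    by (auto simp: loop_def cup_def algebra_simps)
qed

section \<open>Recovering a Jones word from its diagram\<close>

lemma diagram_above:
  assumes "\<And>i. i \<in> set w \<Longrightarrow> r < i"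
  shows "diagram w (int r) = - int r - 1" "diagram w (- int r - 1) = int r"
proof -
  have m: "matching (diagram v)" for v
    by (simp add: matching_foldr matching_idm)
  have "diagram w (int r) = - int r - 1 \<and> diagram w (- int r - 1) = int r"
    using assms
  proof (induction w)
    case (Cons i w)
    then have "r < i" by simp
    moreover from this have "int r \<noteq> int i + 1" by linarith
    ultimately show ?case using Cons m[of w] by (auto simp: cup_def[of i])
  qed (simp add: idm_def)
  then show "diagram w (int r) = - int r - 1" "diagram w (- int r - 1) = int r" by auto
qed

text \<open>The product E_k ... E_(i-1) E_i E_(i-1) ... E_k collapses from its middle by
  \<open>cup_up\<close>. Multiplying by the ascending part thus strips a block down to its last
  letter.\<close>

lemma ascent_descent:
  assumes "matching \<mu>" "k \<le> i"
  shows "foldr cup ([k..<i] @ descent i k) \<mu> = cup k \<mu>"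
  using assms(2)
proof (induction i rule: dec_induct)
  case base
  then show ?case by simp
next
  case (step i)
  let ?\<nu> = "foldr cup (rev [k..<i]) \<mu>"
  have "matching ?\<nu>" using assms(1) by (rule matching_foldr)
  then have "cup i (cup (Suc i) (cup i ?\<nu>)) = cup i ?\<nu>" by (rule cup_up)
  with step show ?case by (simp add: descent_def)
qed

text \<open>\<open>cup k\<close> forgets only how k and k + 1 were attached. If k was joined to a
  known bottom point \<open>p\<close>, then the new partner of \<open>p\<close> is the old partner
  of k + 1, and everything can be recovered.\<close>

lemma cup_eqD:
  assumes "matching \<mu>" "matching \<nu>" "cup k \<mu> = cup k \<nu>" "\<mu> (int k) = p" "\<nu> (int k) = p" "p < 0"
  shows "\<mu> = \<nu>"
proof
  fix x
  have c: "cup k \<mu> x = cup k \<nu> x" for x using assms(3) by simp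
  show "\<mu> x = \<nu> x"
    using c[of x] c[of p] assms(1,2,4-6) unfolding matching_def cup_def by (smt (verit))
qed

lemma diagram_descent:
  assumes \<nu>: "matching \<nu>" "\<And>r. r \<le> k \<Longrightarrow> \<nu> (int r) = - int r - 1"
    and nocap: "\<And>r. r \<le> i \<Longrightarrow> \<nu> (int r) \<noteq> int r + 1" and "k \<le> i"
  defines "\<mu> \<equiv> foldr cup (descent i k) \<nu>"
  shows "\<mu> (int i) = int i + 1" "\<mu> (int k) \<noteq> - int k - 1"
    "\<And>r. r < i \<Longrightarrow> \<mu> (int r) \<noteq> int r + 1"
proof -
  define F where "F s = foldr cup (descent s k) \<nu>" for s
  have m: "matching (F s)" for s
    unfolding F_def using \<nu>(1) by (rule matching_foldr)
  have F_Suc: "F (Suc s) = cup (Suc s) (F s)" if "k \<le> s" for s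
    using that by (simp add: F_def descent_rec)
  have "F s (int s) = int s + 1 \<and> F s (int k) \<noteq> - int k - 1 \<and>
      (\<forall>r. Suc r < s \<longrightarrow> F s (int r) \<noteq> int r + 1) \<and>
      (0 < s \<longrightarrow> s < i \<longrightarrow> F s (int s - 1) \<noteq> int s + 2) \<and>
      (k = s \<longrightarrow> s < i \<longrightarrow> F s (int s + 2) \<noteq> - int k - 1) \<and>
      (\<forall>r. s < r \<longrightarrow> r \<le> i \<longrightarrow> F s (int r) \<noteq> int r + 1)" (is "?I s")
    if "s \<le> i" "k \<le> s" for s
    using that(2,1)
  proof (induction s rule: dec_induct)
    case base
    have F: "F k = cup k \<nu>" by (simp add: F_def)
    have mm: "\<nu> (\<nu> x) = x" "\<nu> x \<noteq> x" for x using \<nu>(1) by (auto simp: matching_def)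
    have F_at: "F k x = (if x = int k then int k + 1 else if x = int k + 1 then int k
        else if x = - int k - 1 then \<nu> (int k + 1) else if \<nu> x = int k + 1 then - int k - 1 else \<nu> x)" for x
      unfolding F cup_def using \<nu>(2)[of k] mm(1)[of x] mm(1)[of "int k"] by auto
    have "F k (int r) \<noteq> int r + 1" if "r \<noteq> k" "r \<le> i" for r
      using nocap[of r] that unfolding F_at by auto
    moreover have "F k (int k + 2) \<noteq> - int k - 1" if "k < i"
    proof -
      have "\<nu> (int k + 1) \<noteq> int k + 2" using nocap[of "Suc k"] that by (simp add: add.commute)
      then show ?thesis unfolding F_at using mm(1)[of "int k + 2"] mm(1)[of "int k"] \<nu>(2)[of k] by auto
    qed
    moreover have "F k (int k - 1) \<noteq> int k + 2" if "0 < k"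
    proof -
      have "\<nu> (int k - 1) = - int k" using \<nu>(2)[of "k - 1"] that by (simp add: of_nat_diff)
      then show ?thesis using that unfolding F_at by auto
    qed
    ultimately show ?case using F_at[of "int k"] base by auto
  next
    case (step s)
    then have I: "?I s" by simp
    have mm: "F s (F s x) = x" "F s x \<noteq> x" for x using m[of s] by (auto simp: matching_def)
    have cap: "F s (int s) = int s + 1" "F s (int s + 1) = int s" using I mm(1)[of "int s"] by auto
    have F_at: "F (Suc s) x = (if x = int s + 1 then int s + 2 else if x = int s + 2 then int s + 1
        else if x = int s then F s (int s + 2) else if F s x = int s + 2 then int s else F s x)" for x
      unfolding F_Suc[OF step(1)] cup_def using cap mm(1)[of x] by (auto simp: algebra_simps)
    have 1: "F (Suc s) (int k) \<noteq> - int k - 1"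
    proof (cases "k = s")
      case True
      then show ?thesis using I step unfolding F_at by auto
    next
      case False
      then show ?thesis using I step unfolding F_at by auto
    qed
    have 2: "F (Suc s) (int r) \<noteq> int r + 1" if "Suc r < Suc s" for r
    proof (cases "Suc r = s")
      case True
      then have "F s (int r) \<noteq> int s + 2" using I step by auto
      moreover have "F s (int r) \<noteq> int s" using cap mm(1)[of "int r"] True by auto
      ultimately show ?thesis using True unfolding F_at by auto
    next
      case False
      then show ?thesis using I that unfolding F_at by auto
    qed
    have 3: "F (Suc s) (int (Suc s) - 1) \<noteq> int (Suc s) + 2" if "Suc s < i"
    proof -
      have "F s (int s + 2) \<noteq> int s + 3" using I that by (auto dest!: spec[of _ "s + 2"] simp: add.commute)
      then show ?thesis unfolding F_at by auto
    qed
    have 4: "F (Suc s) (int r) \<noteq> int r + 1" if "Suc s < r" "r \<le> i" for r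
    proof -
      have "F s (int r) \<noteq> int r + 1" using I that by auto
      then show ?thesis using that unfolding F_at by auto
    qed
    have 5: "F (Suc s) (int (Suc s)) = int (Suc s) + 1" unfolding F_at by simp
    show ?case using 1 2 3 4 5 step by auto
  qed
  from this[of i] have I: "?I i" using assms(4) by simp
  then show "\<mu> (int i) = int i + 1" "\<mu> (int k) \<noteq> - int k - 1"
    by (simp_all add: \<mu>_def F_def)
  have "F i (int r) \<noteq> int r + 1" if "r < i" for r
  proof (cases "Suc r = i")
    case True
    show ?thesis
    proof
      assume "F i (int r) = int r + 1"
      then have "F i (int r) = int i" using True by auto
      then have "F i (int i) = int r" using m[of i] unfolding matching_def by metis
      then show False using I True by auto
    qed
  next
    case False
    then show ?thesis using that I by auto
  qed
  then show "\<And>r. r < i \<Longrightarrow> \<mu> (int r) \<noteq> int r + 1" by (simp add: \<mu>_def F_def)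
qed

lemma jones_lower: "jones ((i, k) # bs) \<Longrightarrow> a \<in> set (jword bs) \<Longrightarrow> k < a"
  by (induction bs arbitrary: i) auto

text \<open>\<open>t\<close> bounds the first top from below and is free when \<open>bs\<close> is
  empty, so one induction hypothesis covers both kinds of tail. It supplies the \<open>nocap\<close>
  premise of \<open>diagram_descent\<close>.\<close>

lemma jones_nocap: "jones bs \<Longrightarrow> (\<And>i k cs. bs = (i, k) # cs \<Longrightarrow> t \<le> i) \<Longrightarrow> r < t \<Longrightarrow>
    diagram (jword bs) (int r) \<noteq> int r + 1"
proof (induction bs arbitrary: t r)
  case Nil
  then show ?case by (simp add: idm_def)
next
  case (Cons b bs)
  obtain i k where b: "b = (i, k)" by force
  have j: "jones ((i, k) # bs)" using Cons.prems(1) b by simp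
  have "diagram (jword bs) (int r) \<noteq> int r + 1" if "r \<le> i" for r
  proof (rule Cons.IH[where t = "Suc i"])
    show "Suc i \<le> i'" if "bs = (i', k') # cs" for i' k' cs using j that by simp
  qed (use j that in auto)
  moreover have "diagram (jword bs) (int r) = - int r - 1" if "r \<le> k" for r
    by (rule diagram_above) (use jones_lower[OF j] that in \<open>meson order_le_less_trans\<close>)
  ultimately have "r < i \<Longrightarrow> foldr cup (descent i k) (diagram (jword bs)) (int r) \<noteq> int r + 1"
    using j by (intro diagram_descent(3)) (auto intro: matching_foldr matching_idm)
  then show ?case using Cons.prems(2)[of i k bs] Cons.prems(3) b by simp
qed

text \<open>These facts make the first block visible: \<open>i\<close> is the leftmost cap on the
  top line and \<open>k\<close> the leftmost strand that is not vertical. The last one supplies the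
  bottom point needed by \<open>cup_eqD\<close> to strip the block.\<close>

lemma jones_head:
  assumes j: "jones ((i, k) # bs)"
  defines "\<mu> \<equiv> diagram (jword ((i, k) # bs))"
  shows "\<mu> (int i) = int i + 1" "\<mu> (int k) \<noteq> - int k - 1" "\<And>r. r < i \<Longrightarrow> \<mu> (int r) \<noteq> int r + 1"
    "\<And>r. r < k \<Longrightarrow> \<mu> (int r) = - int r - 1" "diagram (jword bs) (int k) = - int k - 1"
proof -
  have 1: "diagram (jword bs) (int r) \<noteq> int r + 1" if "r \<le> i" for r
    by (rule jones_nocap[where t = "Suc i"]) (use j that in auto)
  have 2: "diagram (jword bs) (int r) = - int r - 1" if "r \<le> k" for r
    by (rule diagram_above) (use jones_lower[OF j] that in \<open>meson order_le_less_trans\<close>)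
  have 3: "k \<le> i" "matching (diagram (jword bs))"
    using j by (auto intro: matching_foldr matching_idm)
  note d = diagram_descent[OF 3(2) 2 1 3(1)]
  show "\<mu> (int i) = int i + 1" "\<mu> (int k) \<noteq> - int k - 1" "\<And>r. r < i \<Longrightarrow> \<mu> (int r) \<noteq> int r + 1"
    using d by (simp_all add: \<mu>_def)
  show "\<mu> (int r) = - int r - 1" if "r < k" for r
    unfolding \<mu>_def
  proof (rule diagram_above)
    fix a assume "a \<in> set (jword ((i, k) # bs))"
    then show "r < a" using jones_lower[OF j, of a] that by auto
  qed
  show "diagram (jword bs) (int k) = - int k - 1" using 2 by simp
qed

theorem jones_diagram_inj:
  assumes "jones bs" "jones cs" "diagram (jword bs) = diagram (jword cs)"
  shows "bs = cs"
  using assms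
proof (induction bs arbitrary: cs)
  case Nil
  show ?case
  proof (cases cs)
    case (Cons c cs')
    obtain i k where "c = (i, k)" by force
    then have "diagram (jword cs) (int i) = int i + 1" using jones_head(1) Nil Cons by blast
    moreover have "diagram (jword cs) = idm"
      using Nil(3)[symmetric] by (simp only: jword_simps foldr_Nil id_apply)
    then have "diagram (jword cs) (int i) = - int i - 1" by (simp only: idm_def)
    ultimately show ?thesis by simp
  qed simp
next
  case (Cons b bs)
  obtain i k where b: "b = (i, k)" by force
  have jb: "jones ((i, k) # bs)" using Cons.prems(1) b by simp
  show ?case
  proof (cases cs)
    case Nil
    then have "diagram (jword ((i, k) # bs)) = idm" using Cons.prems(3) b by simp
    then have "diagram (jword ((i, k) # bs)) (int i) = - int i - 1" by (simp only: idm_def)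
    then show ?thesis using jones_head(1)[OF jb] by linarith
  next
    case (Cons c cs')
    obtain i' k' where c: "c = (i', k')" by force
    have jc: "jones ((i', k') # cs')" using Cons.prems(2) c Cons by simp
    have eq: "diagram (jword ((i, k) # bs)) = diagram (jword ((i', k') # cs'))"
      using Cons.prems(3) b c Cons by simp
    note hb = jones_head[OF jb] and hc = jones_head[OF jc, folded eq]
    have i: "i = i'" using hb(1) hb(3)[of i'] hc(1) hc(3)[of i] by (meson linorder_cases)
    have k: "k = k'" using hb(2) hb(4)[of k'] hc(2) hc(4)[of k] by (meson linorder_cases)
    have eq': "foldr cup (descent i k) (diagram (jword bs)) = foldr cup (descent i k) (diagram (jword cs'))"
      using eq unfolding i k by (simp only: jword_simps foldr_append o_apply)
    have m: "matching (diagram w)" for w by (intro matching_foldr matching_idm)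
    \<comment> \<open>The descending block is not invertible; stacking the ascending word on both
      sides leaves only \<open>cup k\<close>, which \<open>cup_eqD\<close> can remove.\<close>
    have "foldr cup ([k..<i] @ descent i k) (diagram (jword bs))
        = foldr cup ([k..<i] @ descent i k) (diagram (jword cs'))"
      by (simp only: foldr_append o_apply eq')
    then have "cup k (diagram (jword bs)) = cup k (diagram (jword cs'))"
      using ascent_descent[OF m] jb by (simp only: jones.simps)
    then have "diagram (jword bs) = diagram (jword cs')"
      using hb(5) hc(5)[folded k] m[of "jword bs"] m[of "jword cs'"]
      by (rule_tac cup_eqD[where k = k and p = "- int k - 1"]) simp_all
    then have "bs = cs'" using Cons.IH[of cs'] jb jc by (simp only: jones.simps)
    then show ?thesis using b c Cons i k by (simp only:)
  qed
qed

section \<open>The number of Jones words\<close>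

text \<open>The bounds on block ends and on block tops are separate parameters because removing a
  first block \<open>(i, j)\<close> raises them to \<open>Suc j\<close> and \<open>Suc i\<close>
  independently.\<close>

definition jones_set :: "nat \<Rightarrow> nat \<Rightarrow> nat \<Rightarrow> (nat \<times> nat) list set" where
  "jones_set m k t = {bs. jones bs \<and> (\<forall>(i, j) \<in> set bs. k \<le> j \<and> t \<le> i \<and> i < m)}"

definition jones_set_hd :: "nat \<Rightarrow> nat \<Rightarrow> nat \<Rightarrow> (nat \<times> nat) list set" where
  "jones_set_hd m k t = {bs \<in> jones_set m k t. bs \<noteq> [] \<and> fst (hd bs) = t}"

lemma Nil_in_jones_set [simp]: "[] \<in> jones_set m k t"
  by (simp add: jones_set_def)

lemma Cons_in_jones_set [simp]:
  "(i, j) # bs \<in> jones_set m k t \<longleftrightarrow>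
     k \<le> j \<and> j \<le> i \<and> t \<le> i \<and> i < m \<and> bs \<in> jones_set m (Suc j) (Suc i)"
  unfolding jones_set_def by (auto simp: split_def)

lemma finite_jones_set: "finite (jones_set m k t)"
proof -
  have "set bs \<subseteq> {..<m} \<times> {..<m} \<and> sorted_wrt (<) (map fst bs)" if "bs \<in> jones_set m k t" for bs
    using that
  proof (induction bs arbitrary: k t)
    case (Cons b bs)
    obtain i j where b: "b = (i, j)" by force
    from Cons have "bs \<in> jones_set m (Suc j) (Suc i)" "j \<le> i" "i < m" by (auto simp: b)
    moreover from this(1) have "\<forall>x \<in> set bs. i < fst x" by (auto simp: jones_set_def)
    ultimately show ?case using Cons.IH[of "Suc j" "Suc i"] b by simp
  qed simp
  moreover have "distinct bs" if "sorted_wrt (<) (map fst bs)" for bs :: "(nat \<times> nat) list"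
    using that distinct_map strict_sorted_iff by blast
  ultimately have "jones_set m k t \<subseteq> {bs. set bs \<subseteq> {..<m} \<times> {..<m} \<and> distinct bs}"
    by blast
  moreover have "finite {bs. set bs \<subseteq> {..<m} \<times> {..<m} \<and> distinct bs}"
    by (rule finite_subset_distinct) simp
  ultimately show ?thesis by (rule finite_subset)
qed

lemma in_jones_set_hd:
  "bs \<in> jones_set_hd m k t \<longleftrightarrow>
     (\<exists>j cs. bs = (t, j) # cs \<and> k \<le> j \<and> j \<le> t \<and> t < m \<and> cs \<in> jones_set m (Suc j) (Suc t))"
  by (cases bs) (auto simp: jones_set_hd_def)

lemma in_jones_set_cases:
  "bs \<in> jones_set m k t \<longleftrightarrow> bs = [] \<or>
     (\<exists>i j cs. bs = (i, j) # cs \<and> k \<le> j \<and> j \<le> i \<and> t \<le> i \<and> i < m \<and> cs \<in> jones_set m (Suc j) (Suc i))"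
  by (cases bs) auto

lemma jones_set_split_top: "jones_set m k t = jones_set m k (Suc t) \<union> jones_set_hd m k t"
  unfolding set_eq_iff Un_iff in_jones_set_hd
    in_jones_set_cases[of _ m k t] in_jones_set_cases[of _ m k "Suc t"]
  by (auto simp: Suc_le_eq le_less)

lemma jones_set_split_bottom:
  assumes "k \<le> t" "t < m"
  shows "jones_set_hd m k t = jones_set_hd m (Suc k) t \<union> (#) (t, k) ` jones_set m (Suc k) (Suc t)"
  unfolding set_eq_iff Un_iff in_jones_set_hd image_iff
  using assms by (auto simp: Suc_le_eq le_less)

text \<open>Write N for the count and H for that of \<open>jones_set_hd\<close>. Splitting by the
  first top and then by its end gives N(k,t) = N(k,t+1) + H(k,t) and H(k,t) = H(k+1,t) + N(k+1,t+1);
  the last two terms recombine to N(k+1,t). This is the lattice path recursion of the ballot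
  numbers.\<close>

lemma card_jones_set_rec:
  assumes "k \<le> t" "t < m"
  shows "card (jones_set m k t) = card (jones_set m k (Suc t)) + card (jones_set m (Suc k) t)"
proof -
  have fin: "finite (jones_set_hd m k t)" for k t
    using finite_jones_set[of m k t] by (simp add: jones_set_hd_def)
  have top: "card (jones_set m k t) = card (jones_set m k (Suc t)) + card (jones_set_hd m k t)" for k
    unfolding jones_set_split_top[of m k t]
    by (rule card_Un_disjoint)
      (auto simp: finite_jones_set fin in_jones_set_hd)
  have "card (jones_set_hd m k t)
      = card (jones_set_hd m (Suc k) t) + card ((#) (t, k) ` jones_set m (Suc k) (Suc t))"
    unfolding jones_set_split_bottom[OF assms]
    by (rule card_Un_disjoint) (auto simp: finite_jones_set fin in_jones_set_hd)
  also have "card ((#) (t, k) ` jones_set m (Suc k) (Suc t)) = card (jones_set m (Suc k) (Suc t))"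
    by (rule card_image) simp
  finally show ?thesis using top[of k] top[of "Suc k"] by simp
qed

lemma jones_set_top_ge: "m \<le> t \<Longrightarrow> jones_set m k t = {[]}"
  unfolding set_eq_iff in_jones_set_cases[of _ m k t] by auto

text \<open>A top is never below its end. This closes the recursion at the diagonal, where it would
  ask for tops one step too low.\<close>

lemma jones_set_top_less: "jones_set m (Suc k) k = jones_set m (Suc k) (Suc k)"
  unfolding set_eq_iff in_jones_set_cases[of _ m "Suc k"] by auto

lemma central_binomial_Suc: "(2 * Suc a choose Suc a) = 2 * ((2 * a + 1) choose a)"
proof -
  have "((2 * a + 1) choose Suc a) = ((2 * a + 1) choose a)"
    using binomial_symmetric[of a "2 * a + 1"] by simp
  then show ?thesis by simp
qed

text \<open>The right side is a + 2 times the ballot number for a + 1 against b votes. Here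
  \<open>a\<close> counts the available letters and \<open>b\<close> the admissible tops; b = a will
  give the Catalan number.\<close>

lemma card_jones_set_ballot:
  "(a + 2) * card (jones_set (k + a) k (k + a - b)) = (a + 2 - b) * ((a + 1 + b) choose b)" if "b \<le> a"
  using that
proof (induction "a + b" arbitrary: a b k rule: less_induct)
  case less
  show ?case
  proof (cases b)
    case 0
    then show ?thesis by (simp add: jones_set_top_ge)
  next
    case (Suc c)
    then obtain a' where a: "a = Suc a'" using less.prems by (cases a) auto
    define t where "t = k + a - b"
    have rec: "card (jones_set (k + a) k t) = card (jones_set (k + a) k (Suc t)) + card (jones_set (k + a) (Suc k) t)"
      using Suc less.prems a by (intro card_jones_set_rec) (auto simp: t_def)
    have 1: "(a + 2) * card (jones_set (k + a) k (Suc t)) = (a + 2 - c) * ((a + 1 + c) choose c)"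
    proof -
      have "Suc t = k + a - c" using less.prems Suc by (simp add: t_def)
      then show ?thesis using less.hyps[of a c k] less.prems Suc by simp
    qed
    \<comment> \<open>For b = a the pair (a - 1, b) leaves the range of the formula.
      \<open>jones_set_top_less\<close> replaces it by (a - 1, a - 1), whose value agrees with the
      formula by \<open>central_binomial_Suc\<close>.\<close>
    have 2: "(a + 1) * card (jones_set (k + a) (Suc k) t) = (a + 1 - b) * ((a + b) choose b)"
    proof (cases "b = a")
      case True
      then have "card (jones_set (k + a) (Suc k) t) = card (jones_set (Suc k + a') (Suc k) (Suc k + a' - a'))"
        using a jones_set_top_less[of "k + a" k] by (simp add: t_def)
      then have "(a' + 2) * card (jones_set (k + a) (Suc k) t) = 2 * ((a' + 1 + a') choose a')"
        using less.hyps[of a' a' "Suc k"] a True by simp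
      moreover have "2 * ((a' + 1 + a') choose a') = ((a + b) choose b)"
        using central_binomial_Suc[of a'] a True by (simp add: mult_2)
      ultimately show ?thesis using True a by simp
    next
      case False
      then show ?thesis using less.hyps[of a' b "Suc k"] less.prems a by (simp add: t_def)
    qed
    \<comment> \<open>The two terms of the recursion carry denominators a + 2 and a + 1; the extra
      factor clears both and is cancelled afterwards.\<close>
    have "(a + 1) * ((a + 2) * card (jones_set (k + a) k t)) = (a + 1) * ((a + 2 - b) * ((a + 1 + b) choose b))"
    proof -
      define P Q where "P = ((a + b) choose c)" and "Q = ((a + b) choose b)"
      obtain d where d: "a = b + d" using less.prems le_Suc_ex by blast
      define x y where "x = card (jones_set (k + a) k (Suc t))" and "y = card (jones_set (k + a) (Suc k) t)"
      have PQ: "b * Q = (a + 1) * P"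
        using binomial_absorb_comp[of "a + b" c] binomial_absorption[of c "a + b"] Suc
        by (simp add: P_def Q_def)
      have e: "a + 1 + c = a + b" "a + 2 - c = d + 3" "a + 1 - b = d + 1" "a + 2 - b = d + 2"
        using Suc d by auto
      have x: "(a + 2) * x = (d + 3) * P"
        using 1 unfolding e x_def P_def .
      have y: "(a + 1) * y = (d + 1) * Q"
        using 2 unfolding e y_def Q_def .
      have "(a + 1) * ((a + 2) * (x + y)) = (a + 1) * ((a + 2) * x) + (a + 2) * ((a + 1) * y)"
        by (simp add: algebra_simps)
      also have "\<dots> = (d + 3) * ((a + 1) * P) + (a + 2) * (d + 1) * Q"
        unfolding x y by (simp add: algebra_simps)
      also have "\<dots> = (d + 2) * (b * Q) + (a + 1) * (d + 2) * Q"
        unfolding PQ[symmetric] by (simp add: d algebra_simps)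
      also have "\<dots> = (a + 1) * ((d + 2) * (P + Q))"
        unfolding PQ by (simp add: algebra_simps)
      finally show ?thesis
        using Suc unfolding rec e x_def y_def P_def Q_def by simp
    qed
    then have "(a + 2) * card (jones_set (k + a) k t) = (a + 2 - b) * ((a + 1 + b) choose b)"
      by (simp only: mult_cancel1) simp
    then show ?thesis by (simp add: t_def)
  qed
qed

lemma card_jones_set: "card (jones_set (k + a) k k) = catalan (Suc a)"
proof -
  have "(a + 2) * card (jones_set (k + a) k k) = 2 * ((2 * a + 1) choose a)"
    using card_jones_set_ballot[of a a k] by (simp add: mult_2)
  also have "\<dots> = (2 * Suc a choose Suc a)"
    using central_binomial_Suc[of a] by simp
  also have "\<dots> = (a + 2) * catalan (Suc a)"
    using Suc_mult_catalan[of "Suc a"] by simp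
  finally show ?thesis by (simp only: mult_cancel1) simp
qed

section \<open>The ideal generated by the letter 0\<close>

text \<open>The factor \<open>T (- 1)\<close> turns e_0^2 = \<delta>^2 e_0 and e_0 e_1 e_0 =
  \<delta> e_0 into z_0^2 = \<delta> z_0 and z_0 e_1 z_0 = z_0. \<open>T\<close> and
  \<open>E\<close> are arguments so that the same recursion applies to the opposite action.\<close>

fun zop :: "(int \<Rightarrow> 'a \<Rightarrow> 'a) \<Rightarrow> (nat \<Rightarrow> 'a \<Rightarrow> 'a) \<Rightarrow> nat \<Rightarrow> 'a \<Rightarrow> 'a" where
  "zop T E 0 x = T (- 1) (E 0 x)"
| "zop T E (Suc i) x = E (Suc i) (zop T E i (E (Suc i) x))"

definition zletter :: "nat \<Rightarrow> nat list" where
  "zletter i = rev [1..<Suc i] @ 0 # [1..<Suc i]"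

definition zword :: "nat list \<Rightarrow> nat list" where
  "zword w = concat (map zletter w)"

lemma zletter_Suc: "zletter (Suc i) = Suc i # zletter i @ [Suc i]"
  by (simp add: zletter_def)

lemma zletter_0: "zletter 0 = [0]"
  by (simp add: zletter_def)

lemma zword_simps [simp]: "zword [] = []" "zword (i # w) = zletter i @ zword w"
  by (simp_all add: zword_def)

lemma set_zletter: "set (zletter i) = {..i}"
  by (auto simp: zletter_def)

lemma set_zword: "set (zword w) = (\<Union>i \<in> set w. {..i})"
  by (auto simp: zword_def set_zletter)

text \<open>Representatives are words in the original letters, so z_i is spelled out without its
  factor \<delta>^-1. The empty list is removed from the second family because it yields the
  identity, already in the first.\<close>

definition DTL_words :: "nat \<Rightarrow> nat list set" where
  "DTL_words n = jword ` jones_set n 1 1 \<union> (\<lambda>bs. zword (jword bs)) ` (jones_set n 0 0 - {[]})"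

lemma jones_set_letters:
  assumes "jones bs" "set (jword bs) \<subseteq> {k..<m}"
  shows "bs \<in> jones_set m k k"
proof -
  have "j \<le> i \<and> {i, j} \<subseteq> set (jword bs)" if "(i, j) \<in> set bs" for i j
  proof -
    have "j \<le> i" using assms(1) that by (induction bs rule: jones.induct) auto
    then show ?thesis using that by (force simp: jword_def)
  qed
  then show ?thesis using assms by (fastforce simp: jones_set_def)
qed

section \<open>Absorption of e_i into z_i next to the letter 0\<close>

locale DTL_action = scaled_action T E "{..<n}" for T :: "int \<Rightarrow> 'a \<Rightarrow> 'a" and E n +
  assumes sq0: "0 < n \<Longrightarrow> E 0 (E 0 x) = T 2 (E 0 x)"
    and sq: "1 \<le> i \<Longrightarrow> i < n \<Longrightarrow> E i (E i x) = T 1 (E i x)"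
    and comm: "Suc i < j \<Longrightarrow> j < n \<Longrightarrow> E i (E j x) = E j (E i x)"
    and triple_up: "1 \<le> i \<Longrightarrow> Suc i < n \<Longrightarrow> E i (E (Suc i) (E i x)) = E i x"
    and triple_down: "1 \<le> i \<Longrightarrow> Suc i < n \<Longrightarrow> E (Suc i) (E i (E (Suc i) x)) = E (Suc i) x"
    and triple0: "1 < n \<Longrightarrow> E 0 (E 1 (E 0 x)) = T 1 (E 0 x)"
begin

abbreviation "Z \<equiv> zop T E"

sublocale positive: TL_action T E "{1..<n}"
  by unfold_locales (auto simp: E_T sq triple_up triple_down intro: comm)

lemma Z_T: "i < n \<Longrightarrow> Z i (T k x) = T k (Z i x)"
  by (induction i arbitrary: x) (simp_all add: E_T add.commute)

lemma E0_Z0: "E 0 x = T 1 (Z 0 x)"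
  by simp

lemma Z0_E1_Z0: "1 < n \<Longrightarrow> Z 0 (E 1 (Z 0 x)) = Z 0 x"
  by (simp add: E_T triple0[simplified])

lemma E_foldr_comm:
  assumes "a < n" "set w \<subseteq> {..<n}" "\<And>b. b \<in> set w \<Longrightarrow> Suc a < b"
  shows "E a (foldr E w x) = foldr E w (E a x)"
  using assms(2,3) by (induction w) (auto simp: comm)

lemma Z0_foldr_comm:
  assumes "set w \<subseteq> {2..<n}"
  shows "Z 0 (foldr E w x) = foldr E w (Z 0 x)"
proof (cases w)
  case (Cons a v)
  then have "0 < n" using assms by auto
  then have "E 0 (foldr E w x) = foldr E w (E 0 x)"
    using assms by (intro E_foldr_comm) auto
  moreover have "set w \<subseteq> {..<n}" using assms by auto
  ultimately show ?thesis by (simp add: foldr_T)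
qed simp

text \<open>The outer words commute out of the way until \<open>Z 0 (E 1 (Z 0 _))\<close> is left in
  the middle; \<open>E 1\<close> then passes \<open>v\<close>, whose letters are at least 3.\<close>

lemma Z1_absorb_aux:
  assumes "1 < n" "set v \<subseteq> {3..<n}" "set w \<subseteq> {2..<n}"
  shows "E 1 (Z 0 (foldr E v (E 1 (foldr E w (E 0 x))))) = foldr E v (E 1 (foldr E w (E 0 x)))"
proof -
  have v: "set v \<subseteq> {..<n}" "set v \<subseteq> {2..<n}" using assms(2) by auto
  have w: "set w \<subseteq> {..<n}" using assms(3) by auto
  have E0: "foldr E w (E 0 x) = T 1 (Z 0 (foldr E w x))"
    unfolding E0_Z0 Z0_foldr_comm[OF assms(3)] using w by (simp add: foldr_T)
  have "Z 0 (foldr E v (E 1 (foldr E w (E 0 x)))) = foldr E v (T 1 (Z 0 (E 1 (Z 0 (foldr E w x)))))"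
    using assms(1) v by (simp only: Z0_foldr_comm E0) (simp add: Z_T E_T)
  also have "\<dots> = foldr E v (foldr E w (E 0 x))"
    using assms(1) by (simp only: Z0_E1_Z0 E0)
  finally have "Z 0 (foldr E v (E 1 (foldr E w (E 0 x)))) = foldr E v (foldr E w (E 0 x))" .
  moreover have "E 1 (foldr E v y) = foldr E v (E 1 y)" for y
    using assms v by (intro E_foldr_comm) auto
  ultimately show ?thesis by simp
qed

lemma Z1_absorb:
  assumes "1 < n" "set u \<subseteq> {1..<n}"
  shows "Z 1 (foldr E u (E 0 x)) = E 1 (foldr E u (E 0 x))"
proof -
  obtain k bs where bs: "jones bs" "set (jword bs) \<subseteq> set u"
    "\<And>x. foldr E u x = T k (foldr E (jword bs) x)"
    using positive.foldr_eq_jones[OF assms(2)] by metis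
  \<comment> \<open>The shape accepted by \<open>Z1_absorb_aux\<close>. Ends increase strictly, so
    the letter 1 can only be the last letter of the first block. If that block is just 1, the square
    gives exponent 1; if it is longer, \<open>rise\<close> moves its letters from 3 upwards into
    \<open>v\<close>; if it ends above 1, the whole word serves as \<open>w\<close>.\<close>
  let ?P = "\<lambda>l v w. set v \<subseteq> {3..<n} \<and> set w \<subseteq> {2..<n} \<and>
    (\<forall>y. E 1 (foldr E (jword bs) y) = T l (foldr E v (E 1 (foldr E w y))))"
  have "\<exists>l v w. ?P l v w"
  proof (cases bs)
    case Nil
    then have "?P 0 [] []" by simp
    then show ?thesis by blast
  next
    case (Cons b cs)
    obtain i j where b: "b = (i, j)" by force
    have lower: "j < a" if "a \<in> set (jword cs)" for a
      using bs(1) that unfolding Cons b by (auto simp: jword_def)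
    have ji: "j \<le> i" using bs(1) Cons b by simp
    have letters: "{j..i} \<union> set (jword cs) \<subseteq> {1..<n}" using bs(2) assms(2) Cons b by auto
    then have "1 \<le> j" using ji by auto
    show ?thesis
    proof (cases "j = 1")
      case True
      have set_cs: "set (jword cs) \<subseteq> {2..<n}" using lower True letters by fastforce
      show ?thesis
      proof (cases "i = 1")
        case True
        then have "?P 1 [] (jword cs)"
          using \<open>j = 1\<close> set_cs assms(1) Cons b by (simp add: sq[of 1, simplified])
        then show ?thesis by blast
      next
        case False
        then have "redex (1 # descent i 1) (descent i 3 @ [1])"
          using redex.rise[of 1 i] ji True by (simp add: numeral_3_eq_3)
        moreover have "set (1 # descent i 1) \<subseteq> {1..<n}" using letters True assms(1) by auto
        ultimately obtain l where "\<And>x. foldr E (1 # descent i 1) x = T l (foldr E (descent i 3 @ [1]) x)"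
          using positive.redex_foldr by metis
        moreover have "i < n" using letters ji by auto
        ultimately have "?P l (descent i 3) (jword cs)"
          using set_cs True Cons b by auto
        then show ?thesis by blast
      qed
    next
      case False
      then have "?P 0 [] (jword bs)"
        using \<open>1 \<le> j\<close> lower letters Cons b by (fastforce simp: Suc_le_eq numeral_2_eq_2)
      then show ?thesis by blast
    qed
  qed
  then obtain l v w where vw: "?P l v w" by blast
  have "set (jword bs) \<subseteq> {..<n}" using bs(2) assms(2) by auto
  have "Z 1 (foldr E (jword bs) (E 0 x)) = E 1 (foldr E (jword bs) (E 0 x))"
  proof -
    have 0: "0 < n" "Suc 0 < n" using assms(1) by auto
    have "Z 1 (foldr E (jword bs) (E 0 x)) = E 1 (Z 0 (E 1 (foldr E (jword bs) (E 0 x))))"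
      by simp
    also have "\<dots> = T l (E 1 (Z 0 (foldr E v (E 1 (foldr E w (E 0 x))))))"
      using vw 0 assms(1) by (simp only: Z_T E_T lessThan_iff)
    also have "\<dots> = E 1 (foldr E (jword bs) (E 0 x))"
      using vw assms(1) by (simp only: Z1_absorb_aux)
    finally show ?thesis .
  qed
  then show ?thesis
    using assms(1) by (simp only: bs(3) Z_T E_T lessThan_iff)
qed

text \<open>The inner letter of z_(i+1) = e_(i+1) z_i e_(i+1) is merged into the arbitrary word
  \<open>u\<close>; by induction z_i there acts as e_i, and e_(i+1) e_i e_(i+1) = e_(i+1).\<close>

lemma Z_absorb_left:
  assumes "1 \<le> i" "i < n" "set u \<subseteq> {1..<n}"
  shows "Z i (foldr E u (E 0 x)) = E i (foldr E u (E 0 x))"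
  using assms(1-3)
proof (induction i arbitrary: u rule: dec_induct)
  case base
  then show ?case using Z1_absorb by simp
next
  case (step i)
  have "Z (Suc i) (foldr E u (E 0 x)) = E (Suc i) (Z i (foldr E (Suc i # u) (E 0 x)))"
    by simp
  also have "\<dots> = E (Suc i) (E i (E (Suc i) (foldr E u (E 0 x))))"
    using step.IH[of "Suc i # u"] step.prems step.hyps by simp
  also have "\<dots> = E (Suc i) (foldr E u (E 0 x))"
    using step.prems step.hyps by (simp add: triple_down)
  finally show ?case .
qed

lemma Z_foldr: "i < n \<Longrightarrow> Z i x = T (- 1) (foldr E (zletter i) x)"
  by (induction i arbitrary: x) (simp_all add: zletter_0 zletter_Suc E_T)

lemma foldr_zletter:
  "foldr E (zletter i) x = foldr E (rev [1..<Suc i]) (E 0 (foldr E [1..<Suc i] x))"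
  by (simp add: zletter_def)

lemma E_Z: "1 \<le> i \<Longrightarrow> i < n \<Longrightarrow> j < n \<Longrightarrow> E i (Z j x) = Z i (Z j x)"
  using Z_absorb_left[of i "rev [1..<Suc j]" "foldr E [1..<Suc j] x"]
  by (auto simp: Z_foldr[of j] foldr_zletter Z_T E_T simp del: upt_Suc)

text \<open>Precomposition is an action of the opposite algebra; it turns \<open>Z_absorb_left\<close> into its mirror image.\<close>

lemma opposite: "DTL_action (\<lambda>k f x. f (T k x)) (\<lambda>i f x. f (E i x)) n"
  by unfold_locales
    (simp_all add: fun_eq_iff E_T sq0 sq[simplified] triple_up[simplified] triple_down[simplified]
      triple0[simplified] add.commute, metis comm)

text \<open>The word of z_i is a palindrome, so reversing the order of multiplication gives z_i
  back.\<close>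

lemma zop_opposite: "i < n \<Longrightarrow> zop (\<lambda>k f x. f (T k x)) (\<lambda>i f x. f (E i x)) i f = (\<lambda>x. f (Z i x))"
  by (induction i arbitrary: f) (auto simp: E_T)

lemma foldr_opposite: "foldr (\<lambda>i f x. f (E i x)) w f = (\<lambda>x. f (foldr E (rev w) x))"
  by (induction w arbitrary: f) auto

lemma Z_absorb_right:
  assumes "1 \<le> i" "i < n" "set u \<subseteq> {1..<n}"
  shows "E 0 (foldr E u (Z i x)) = E 0 (foldr E u (E i x))"
proof -
  have "set (rev u) \<subseteq> {1..<n}" using assms(3) by simp
  from DTL_action.Z_absorb_left[OF opposite assms(1,2) this, where x = id]
  have "(\<lambda>x. E 0 (foldr E u (Z i x))) = (\<lambda>x. E 0 (foldr E u (E i x)))"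
    using assms(2) by (simp add: zop_opposite foldr_opposite)
  then show ?thesis by (rule fun_cong)
qed

lemma Z_E: "1 \<le> i \<Longrightarrow> i < n \<Longrightarrow> j < n \<Longrightarrow> Z j (E i x) = Z j (Z i x)"
  using Z_absorb_right[of i "[1..<Suc j]" x]
  by (auto simp: Z_foldr[of j] foldr_zletter simp del: upt_Suc)

lemma Z_E_comm: "Suc i < j \<Longrightarrow> j < n \<Longrightarrow> Z i (E j x) = E j (Z i x)"
proof (induction i arbitrary: x)
  case 0
  then show ?case by (simp add: comm[of 0 j] E_T)
next
  case (Suc i)
  then show ?case by (simp add: comm[of "Suc i" j])
qed

text \<open>Beside another z, e_i and z_i are interchangeable for i >= 1 by \<open>E_Z\<close> and
  \<open>Z_E\<close>, so most relations are inherited from the letters. Only index 0 needs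
  \<open>sq0\<close> and \<open>Z0_E1_Z0\<close>.\<close>

sublocale z: TL_action T Z "{..<n}"
proof
  fix i j x
  show "Z i (T k x) = T k (Z i x)" if "i \<in> {..<n}" for k using that by (simp add: Z_T)
  show "Z i (Z i x) = T 1 (Z i x)" if "i \<in> {..<n}"
  proof (cases i)
    case 0
    then show ?thesis using that by (simp add: E_T sq0)
  next
    case (Suc i')
    then have "Z i (Z i x) = E i (Z i x)" using that E_Z[of i i] by simp
    also have "\<dots> = T 1 (Z i x)" using Suc that by (simp add: sq[simplified])
    finally show ?thesis .
  qed
  show "Z i (Z j x) = Z j (Z i x)" if "i \<in> {..<n}" "j \<in> {..<n}" "Suc i < j"
  proof -
    have "Z i (Z j x) = Z i (E j x)" using that Z_E[of j i] by simp
    also have "\<dots> = E j (Z i x)" using that by (simp add: Z_E_comm)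
    also have "\<dots> = Z j (Z i x)" using that by (intro E_Z) auto
    finally show ?thesis .
  qed
  show "Z i (Z (Suc i) (Z i x)) = Z i x" if "i \<in> {..<n}" "Suc i \<in> {..<n}"
  proof (cases i)
    case 0
    then have "Z i (Z (Suc i) (Z i x)) = Z 0 (E 1 (Z 0 x))" using that E_Z[of 1 0] by simp
    also have "\<dots> = Z 0 x" using that 0 by (intro Z0_E1_Z0) simp
    finally show ?thesis using 0 by simp
  next
    case (Suc i')
    then have "Z i (Z (Suc i) (Z i x)) = E i (E (Suc i) (Z i x))"
      using that E_Z[of i "Suc i" "Z i x"] E_Z[of "Suc i" i x] by (simp del: zop.simps)
    \<comment> \<open>For i >= 1 the operator \<open>Z i\<close> starts with \<open>E i\<close>,
      which completes the pattern of \<open>triple_up\<close>.\<close>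
    also have "\<dots> = Z i x"
      unfolding Suc zop.simps(2) using that Suc by (intro triple_up) auto
    finally show ?thesis .
  qed
  show "Z (Suc i) (Z i (Z (Suc i) x)) = Z (Suc i) x" if "i \<in> {..<n}" "Suc i \<in> {..<n}"
  proof (cases i)
    case 0
    have "Z (Suc i) (Z i (Z (Suc i) x)) = E 1 (Z 0 (E 1 (Z 0 (E 1 x))))"
      using that 0 E_Z[of 1 0 "Z 1 x"] by simp
    also have "\<dots> = E 1 (Z 0 (E 1 x))" using that 0 by (subst Z0_E1_Z0) auto
    finally show ?thesis using 0 by simp
  next
    case (Suc i')
    then have "Z (Suc i) (Z i (Z (Suc i) x)) = E (Suc i) (E i (Z (Suc i) x))"
      using that E_Z[of "Suc i" i "Z (Suc i) x"] E_Z[of i "Suc i" x] by (simp del: zop.simps)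
    also have "\<dots> = Z (Suc i) x"
      unfolding zop.simps(2) using that Suc by (intro triple_down) auto
    finally show ?thesis .
  qed
qed simp_all

text \<open>An occurrence of 0 seeds the conversion: letters to its right become z by
  \<open>Z_E\<close>, then those to its left by \<open>E_Z\<close>. Each 0 contributes one power, as
  e_0 = \<delta> z_0.\<close>

lemma foldr_Z:
  assumes "0 \<in> set w" "set w \<subseteq> {..<n}"
  shows "\<exists>k. \<forall>x. foldr E w x = T k (foldr Z w x)"
proof -
  obtain u v where w: "w = u @ 0 # v" using assms(1) split_list by fastforce
  have n: "0 < n" using assms by auto
  have "set v \<subseteq> {..<n}" using assms(2) w by simp
  then have "\<exists>k. \<forall>x. foldr E (0 # v) x = T k (foldr Z (0 # v) x)"
  proof (induction v rule: rev_induct)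
    case Nil
    have "foldr E [0] x = T 1 (foldr Z [0] x)" for x by simp
    then show ?case by blast
  next
    case (snoc i v)
    then obtain k where k: "\<And>x. foldr E (0 # v) x = T k (foldr Z (0 # v) x)" by auto
    have i: "i < n" and v: "set v \<subseteq> {..<n}" using snoc.prems by auto
    show ?case
    proof (cases i)
      case 0
      have "foldr E (0 # v @ [i]) x = T (k + 1) (foldr Z (0 # v @ [i]) x)" for x
      proof -
        have "foldr E (0 # v @ [i]) x = foldr E (0 # v) (T 1 (Z 0 x))" using 0 by simp
        also have "\<dots> = T k (foldr Z (0 # v) (T 1 (Z 0 x)))" by (rule k)
        also have "\<dots> = T (k + 1) (foldr Z (0 # v) (Z 0 x))"
          using v n by (subst z.foldr_T) (auto simp del: zop.simps)
        finally show ?thesis using 0 by simp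
      qed
      then show ?thesis by blast
    next
      case (Suc i')
      have "foldr Z (0 # v) (E i x) = foldr Z (0 # v) (Z i x)" for x
      proof -
        obtain v' j where v': "0 # v = v' @ [j]" by (metis rev_exhaust list.distinct(1))
        then have "j \<in> set (0 # v)" by simp
        then have "j < n" using v n by auto
        then show ?thesis unfolding v' using i Suc by (simp add: Z_E del: zop.simps)
      qed
      then have "foldr E (0 # v @ [i]) x = T k (foldr Z (0 # v @ [i]) x)" for x
        using k[of "E i x"] by simp
      then show ?thesis by blast
    qed
  qed
  moreover have "set u \<subseteq> {..<n}" using assms(2) w by simp
  ultimately show ?thesis
    unfolding w
  proof (induction u)
    case (Cons i u)
    then obtain k where k: "\<And>x. foldr E (u @ 0 # v) x = T k (foldr Z (u @ 0 # v) x)" by auto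
    have i: "i < n" and uv: "set (u @ 0 # v) \<subseteq> {..<n}" using Cons.prems assms(2) w by auto
    show ?case
    proof (cases i)
      case 0
      have "foldr E (i # u @ 0 # v) x = T (k + 1) (foldr Z (i # u @ 0 # v) x)" for x
        using k[of x] 0 n by (simp add: E_T)
      then show ?thesis by auto
    next
      case (Suc i')
      obtain j w' where w': "u @ 0 # v = j # w'" by (metis append_is_Nil_conv list.exhaust list.distinct(1))
      then have "j < n" using uv by auto
      then have "E i (foldr Z (u @ 0 # v) x) = Z i (foldr Z (u @ 0 # v) x)" for x
        unfolding w' using i Suc E_Z[of i j] by (simp del: zop.simps)
      then have "foldr E (i # u @ 0 # v) x = T k (foldr Z (i # u @ 0 # v) x)" for x
        using k[of x] i by (simp add: E_T del: zop.simps foldr_append)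
      then show ?thesis by auto
    qed
  qed simp
qed

lemma foldr_zword: "set w \<subseteq> {..<n} \<Longrightarrow> foldr Z w x = T (- int (length w)) (foldr E (zword w) x)"
proof (induction w)
  case (Cons i w)
  then have "set (zletter i) \<subseteq> {..<n}" by (auto simp: set_zletter)
  with Cons show ?case by (simp add: Z_foldr foldr_T)
qed simp

theorem foldr_eq_DTL_word:
  assumes "set w \<subseteq> {..<n}"
  shows "\<exists>k r. r \<in> DTL_words n \<and> (\<forall>x. foldr E w x = T k (foldr E r x))"
proof (cases "0 \<in> set w")
  case True
  then obtain k where k: "\<And>x. foldr E w x = T k (foldr Z w x)" using foldr_Z assms by blast
  obtain l bs where bs: "jones bs" "set (jword bs) \<subseteq> set w" "w = [] \<longleftrightarrow> bs = []"
    "\<And>x. foldr Z w x = T l (foldr Z (jword bs) x)"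
    using z.foldr_eq_jones[OF assms] by metis
  have "set (jword bs) \<subseteq> {0..<n}" using bs(2) assms by auto
  then have "bs \<in> jones_set n 0 0 - {[]}"
    using bs(1,3) True by (auto intro: jones_set_letters)
  moreover have "foldr E w x = T (k + l - int (length (jword bs))) (foldr E (zword (jword bs)) x)" for x
    using assms bs(2) by (simp add: k bs(4) foldr_zword algebra_simps)
  ultimately show ?thesis unfolding DTL_words_def by blast
next
  case False
  then have "set w \<subseteq> {1..<n}" using assms by (auto simp: Suc_le_eq intro: gr0I)
  from positive.foldr_eq_jones[OF this] obtain k bs where bs: "jones bs" "set (jword bs) \<subseteq> set w"
    "\<And>x. foldr E w x = T k (foldr E (jword bs) x)" by metis
  have "bs \<in> jones_set n 1 1" using bs(1,2) \<open>set w \<subseteq> {1..<n}\<close> by (intro jones_set_letters) auto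
  then show ?thesis using bs(3) unfolding DTL_words_def by blast
qed

end

section \<open>Bases of presented algebras\<close>

lemma ncpoly_induct [case_names zero add]:
  fixes p :: "'r::comm_ring_1 ncpoly"
  assumes "P 0"
    and "\<And>w a p. w \<notin> Poly_Mapping.keys p \<Longrightarrow> a \<noteq> 0 \<Longrightarrow> P p \<Longrightarrow> P (Poly_Mapping.single w a + p)"
  shows "P p"
proof (induction p rule: update_induct)
  case const
  show ?case by (rule assms(1))
next
  case (update p w a)
  have "Poly_Mapping.update w a p = Poly_Mapping.single w a + p"
    using update.hyps
    by (intro poly_mapping_eqI) (auto simp: lookup_update lookup_add lookup_single when_def in_keys_iff)
  with update assms(2) show ?case by simp
qed

lemma keys_single_add:
  "w \<notin> Poly_Mapping.keys p \<Longrightarrow> a \<noteq> 0 \<Longrightarrow>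
    Poly_Mapping.keys (Poly_Mapping.single w a + p) = insert w (Poly_Mapping.keys p)"
  by (auto simp: in_keys_iff lookup_add lookup_single when_def split: if_splits)

definition lin :: "(nat list \<Rightarrow> 'r) \<Rightarrow> 'r::comm_ring_1 ncpoly \<Rightarrow> 'r" where
  "lin \<phi> p = (\<Sum>w \<in> Poly_Mapping.keys p. Poly_Mapping.lookup p w * \<phi> (letters w))"

lemma lin_superset:
  "finite A \<Longrightarrow> Poly_Mapping.keys p \<subseteq> A \<Longrightarrow> lin \<phi> p = (\<Sum>w \<in> A. Poly_Mapping.lookup p w * \<phi> (letters w))"
  unfolding lin_def by (rule sum.mono_neutral_left) (auto simp: in_keys_iff)

lemma lin_add: "lin \<phi> (p + q) = lin \<phi> p + lin \<phi> q"
proof -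
  let ?A = "Poly_Mapping.keys p \<union> Poly_Mapping.keys q"
  have "Poly_Mapping.keys (p + q) \<subseteq> ?A" by (rule keys_add)
  then show ?thesis
    by (subst (1 2 3) lin_superset[of ?A]) (auto simp: lookup_add distrib_right sum.distrib)
qed

lemma lin_0 [simp]: "lin \<phi> 0 = 0"
  by (simp add: lin_def)

lemma lin_single [simp]: "lin \<phi> (Poly_Mapping.single w a) = a * \<phi> (letters w)"
  by (cases "a = 0") (simp_all add: lin_def)

lemma lin_uminus: "lin \<phi> (- p) = - lin \<phi> p"
  by (simp add: lin_def sum_negf)

lemma lin_diff: "lin \<phi> (p - q) = lin \<phi> p - lin \<phi> q"
  using lin_add[of \<phi> p "- q"] by (simp add: lin_uminus)

lemma lin_sum: "lin \<phi> (\<Sum>x \<in> A. f x) = (\<Sum>x \<in> A. lin \<phi> (f x))"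
  by (induction A rule: infinite_finite_induct) (simp_all add: lin_add)

lemma lin_scalar: "lin \<phi> (scalar a * p) = a * lin \<phi> p"
  by (induction p rule: ncpoly_induct)
    (simp_all add: distrib_left lin_add scalar_def mult_single mult.assoc)

definition monomial :: "nat list \<Rightarrow> 'r::comm_ring_1 ncpoly" where
  "monomial w = Poly_Mapping.single (Word w) 1"

lemma monomial_mult: "monomial u * monomial v = monomial (u @ v)"
  by (simp add: monomial_def mult_single plus_word_def)

lemma single_eq_monomial: "Poly_Mapping.single w a = scalar a * monomial (letters w)"
  by (simp add: monomial_def scalar_def mult_single)

lemma gen_eq_monomial: "gen i = monomial [i]"
  by (simp add: gen_def monomial_def)

lemma lin_monomial [simp]: "lin \<phi> (monomial w) = \<phi> w"
  by (simp add: monomial_def)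

text \<open>Testing all translates of \<open>p\<close>, not only \<open>p\<close>, makes the
  annihilated polynomials a two-sided ideal, so that relators alone need checking.\<close>

definition annihilates :: "(nat list \<Rightarrow> 'r) \<Rightarrow> 'r::comm_ring_1 ncpoly \<Rightarrow> bool" where
  "annihilates \<phi> p \<longleftrightarrow> (\<forall>u v. lin \<phi> (monomial u * p * monomial v) = 0)"

lemma annihilates_mult_left: "annihilates \<phi> p \<Longrightarrow> annihilates \<phi> (x * p)"
proof (induction x rule: ncpoly_induct)
  case (add w a x)
  have "monomial u * (Poly_Mapping.single w a * p) * monomial v = scalar a * (monomial (u @ letters w) * p * monomial v)" for u v
    using scalar_central[of a "monomial u"]
    by (simp add: single_eq_monomial mult.assoc[symmetric] monomial_mult[symmetric])
  with add show ?case
    by (simp add: annihilates_def distrib_left distrib_right lin_add lin_scalar)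
qed (simp add: annihilates_def)

lemma annihilates_mult_right: "annihilates \<phi> p \<Longrightarrow> annihilates \<phi> (p * x)"
proof (induction x rule: ncpoly_induct)
  case (add w a x)
  have "monomial u * (p * Poly_Mapping.single w a) * monomial v = scalar a * (monomial u * p * monomial (letters w @ v))" for u v
    using scalar_central[of a "monomial u * p"]
    by (simp add: single_eq_monomial mult.assoc[symmetric] monomial_mult[symmetric])
  with add show ?case
    by (simp add: annihilates_def distrib_left distrib_right lin_add lin_scalar)
qed (simp add: annihilates_def)

lemma free_algebra_add: "p \<in> carrier (free_algebra n) \<Longrightarrow> q \<in> carrier (free_algebra n) \<Longrightarrow>
    p + q \<in> carrier (free_algebra n)"
  using ring.ring_simprules(1)[OF ring_free_algebra] by (metis free_algebra_simps(1))

lemma free_algebra_mult: "p \<in> carrier (free_algebra n) \<Longrightarrow> q \<in> carrier (free_algebra n) \<Longrightarrow>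
    p * q \<in> carrier (free_algebra n)"
  using ring.ring_simprules(5)[OF ring_free_algebra] by (metis free_algebra_simps(2))

lemma zero_in_free_algebra: "0 \<in> carrier (free_algebra n)"
  by (simp add: free_algebra_def)

lemma uminus_free_algebra:
  assumes "p \<in> carrier (free_algebra n)"
  shows "- p \<in> carrier (free_algebra n)" "\<ominus>\<^bsub>free_algebra n\<^esub> p = - p"
proof -
  interpret F: ring "free_algebra n :: 'a ncpoly ring" by (rule ring_free_algebra)
  show *: "- p \<in> carrier (free_algebra n)"
    using assms by (simp add: free_algebra_def)
  show "\<ominus>\<^bsub>free_algebra n\<^esub> p = - p"
    using assms * by (intro F.minus_equality) (simp_all add: free_algebra_simps)
qed

lemma annihilates_genideal:
  assumes "S \<subseteq> carrier (free_algebra n)" "\<And>s. s \<in> S \<Longrightarrow> annihilates \<phi> s"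
    and "p \<in> Idl\<^bsub>free_algebra n\<^esub> S"
  shows "annihilates \<phi> p"
proof -
  let ?F = "free_algebra n :: 'a ncpoly ring"
  let ?K = "{p \<in> carrier ?F. annihilates \<phi> p}"
  interpret F: ring ?F by (rule ring_free_algebra)
  have "ideal ?K ?F"
  proof (rule idealI[OF ring_free_algebra])
    show "subgroup ?K (add_monoid ?F)"
    proof (rule subgroup.intro)
      show "inv\<^bsub>add_monoid ?F\<^esub> x \<in> ?K" if "x \<in> ?K" for x
      proof -
        have "inv\<^bsub>add_monoid ?F\<^esub> x = - x"
          using that uminus_free_algebra(2)[of x n] by (simp only: a_inv_def mem_Collect_eq)
        then show ?thesis
          using that by (simp only: mem_Collect_eq) (simp add: uminus_free_algebra annihilates_def lin_uminus)
      qed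
    qed (auto simp: free_algebra_simps annihilates_def distrib_left distrib_right lin_add
        intro: free_algebra_add zero_in_free_algebra)
  qed (auto simp: free_algebra_simps annihilates_mult_left annihilates_mult_right
      intro: free_algebra_mult)
  then have "Idl\<^bsub>?F\<^esub> S \<subseteq> ?K"
    using assms(1,2) by (intro F.genideal_minimal) auto
  then show ?thesis using assms(3) by blast
qed

definition proj :: "nat \<Rightarrow> 'r::comm_ring_1 ncpoly set \<Rightarrow> 'r ncpoly \<Rightarrow> 'r ncpoly set" where
  "proj n S p = Idl\<^bsub>free_algebra n\<^esub> S +>\<^bsub>free_algebra n\<^esub> p"

lemma monomial_in_free_algebra: "set w \<subseteq> {..<n} \<Longrightarrow> monomial w \<in> carrier (free_algebra n)"
  by (simp add: monomial_def free_algebra_def)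

context
  fixes n :: nat and S :: "'r::comm_ring_1 ncpoly set"
  assumes S: "S \<subseteq> carrier (free_algebra n)"
begin

private abbreviation "F \<equiv> free_algebra n :: 'r ncpoly ring"
private abbreviation "M \<equiv> presented_algebra n S"
private abbreviation "\<pi> \<equiv> proj n S"

lemma ideal_relators: "ideal (Idl\<^bsub>F\<^esub> S) F"
  using S by (rule ring.genideal_ideal[OF ring_free_algebra])

lemma proj_eq_iff:
  assumes "p \<in> carrier F" "q \<in> carrier F"
  shows "\<pi> p = \<pi> q \<longleftrightarrow> p - q \<in> Idl\<^bsub>F\<^esub> S"
  using ring.quotient_eq_iff_same_a_r_cos[OF ring_free_algebra ideal_relators assms] assms
  by (simp add: proj_def a_minus_def uminus_free_algebra free_algebra_simps)

lemma proj_eqI: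
  assumes "p - q \<in> S" "p \<in> carrier F" "q \<in> carrier F" "r \<in> carrier F"
  shows "\<pi> (p * r) = \<pi> (q * r)"
proof -
  have "p - q \<in> Idl\<^bsub>F\<^esub> S"
    using assms(1) ring.genideal_self[OF ring_free_algebra S] by blast
  from ideal.I_r_closed[OF ideal_relators this assms(4)] show ?thesis
    using assms by (simp add: proj_eq_iff free_algebra_mult free_algebra_simps left_diff_distrib)
qed

lemma proj_hom: "\<pi> \<in> ring_hom F (F Quot Idl\<^bsub>F\<^esub> S)"
  unfolding proj_def[abs_def] by (rule ideal.rcos_ring_hom[OF ideal_relators])

lemma proj_closed: "p \<in> carrier F \<Longrightarrow> \<pi> p \<in> carrier M"
  unfolding presented_algebra_simps by (rule ring_hom_closed[OF proj_hom])

lemma proj_surj: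
  assumes "x \<in> carrier M" obtains p where "p \<in> carrier F" "x = \<pi> p"
  using assms unfolding presented_algebra_simps
  by (auto simp: FactRing_def A_RCOSETS_def' proj_def)

lemma proj_mult: "p \<in> carrier F \<Longrightarrow> q \<in> carrier F \<Longrightarrow> \<pi> p \<otimes>\<^bsub>M\<^esub> \<pi> q = \<pi> (p * q)"
  unfolding presented_algebra_simps using ring_hom_mult[OF proj_hom] by (simp add: free_algebra_simps)

lemma proj_add: "p \<in> carrier F \<Longrightarrow> q \<in> carrier F \<Longrightarrow> \<pi> p \<oplus>\<^bsub>M\<^esub> \<pi> q = \<pi> (p + q)"
  unfolding presented_algebra_simps using ring_hom_add[OF proj_hom] by (simp add: free_algebra_simps)

lemma proj_smult: "p \<in> carrier F \<Longrightarrow> a \<odot>\<^bsub>M\<^esub> \<pi> p = \<pi> (scalar a * p)"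
  unfolding presented_algebra_simps proj_def[symmetric]
  using ring_hom_mult[OF proj_hom scalar_in_free_algebra] by (simp add: free_algebra_simps)

lemma proj_zero: "\<zero>\<^bsub>M\<^esub> = \<pi> 0"
  unfolding presented_algebra_simps
  using ring_hom_zero[OF proj_hom ring_free_algebra ideal.quotient_is_ring[OF ideal_relators]]
  by (simp add: free_algebra_simps)

text \<open>The functionals \<open>\<phi> r\<close> descend to the quotient and are dual to the
  monomials \<open>r\<close> up to units, so they read off coefficients. Units are allowed because a
  representative will pair with its own functional to a power of \<delta>.\<close>

theorem free_module_presented:
  fixes R :: "nat list set" and \<phi> :: "nat list \<Rightarrow> nat list \<Rightarrow> 'r"
  assumes R: "finite R" "\<And>r. r \<in> R \<Longrightarrow> set r \<subseteq> {..<n}"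
    and span: "\<And>w. set w \<subseteq> {..<n} \<Longrightarrow> \<exists>r \<in> R. \<exists>a. \<pi> (monomial w) = a \<odot>\<^bsub>M\<^esub> \<pi> (monomial r)"
    and ann: "\<And>r s. r \<in> R \<Longrightarrow> s \<in> S \<Longrightarrow> annihilates (\<phi> r) s"
    and off: "\<And>r r'. r \<in> R \<Longrightarrow> r' \<in> R \<Longrightarrow> r \<noteq> r' \<Longrightarrow> \<phi> r r' = 0"
    and unit: "\<And>r. r \<in> R \<Longrightarrow> \<phi> r r dvd 1"
  shows "free_module_of_rank (ring_of_type_algebra :: 'r ring) M (card R)"
proof -
  let ?L = "ring_of_type_algebra :: 'r ring"
  interpret M: module ?L M by (rule module_presented_algebra[OF S])
  have L: "carrier ?L = UNIV" by (simp add: ring_of_type_algebra_def)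
  define comb where "comb c = (\<Sum>r \<in> R. scalar (c r) * monomial r)" for c :: "nat list \<Rightarrow> 'r"
  have summand: "scalar a * monomial r \<in> carrier F" if "r \<in> R" for a r
    using that R(2) by (intro free_algebra_mult scalar_in_free_algebra monomial_in_free_algebra)
  have "(\<Sum>r \<in> A. scalar (c r) * monomial r) \<in> carrier F \<and>
      \<pi> (\<Sum>r \<in> A. scalar (c r) * monomial r) = (\<Oplus>\<^bsub>M\<^esub>r\<in>A. c r \<odot>\<^bsub>M\<^esub> \<pi> (monomial r))"
    if "A \<subseteq> R" for A and c :: "nat list \<Rightarrow> 'r"
    using finite_subset[OF that R(1)] that
  proof (induction A rule: finite_induct)
    case empty
    then show ?case by (simp add: zero_in_free_algebra proj_zero)
  next
    case (insert r A)
    have mem: "c r \<odot>\<^bsub>M\<^esub> \<pi> (monomial r) \<in> carrier M" if "r \<in> R" for r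
      using that R(2) by (intro M.smult_closed proj_closed monomial_in_free_algebra) (simp_all add: L)
    have "(\<Oplus>\<^bsub>M\<^esub>r\<in>insert r A. c r \<odot>\<^bsub>M\<^esub> \<pi> (monomial r))
        = c r \<odot>\<^bsub>M\<^esub> \<pi> (monomial r) \<oplus>\<^bsub>M\<^esub> (\<Oplus>\<^bsub>M\<^esub>r\<in>A. c r \<odot>\<^bsub>M\<^esub> \<pi> (monomial r))"
      using insert mem by (intro M.finsum_insert) auto
    moreover have "c r \<odot>\<^bsub>M\<^esub> \<pi> (monomial r) = \<pi> (scalar (c r) * monomial r)"
      using insert.prems R(2) by (intro proj_smult monomial_in_free_algebra) auto
    ultimately show ?case
      using insert summand[of r "c r"] by (simp add: free_algebra_add proj_add[symmetric])
  qed
  from this[of R] have comb_closed: "comb c \<in> carrier F"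
    and comb: "\<pi> (comb c) = (\<Oplus>\<^bsub>M\<^esub>r\<in>R. c r \<odot>\<^bsub>M\<^esub> \<pi> (monomial r))" for c
    by (simp_all add: comb_def)
  have comb_add: "comb c + comb d = comb (\<lambda>r. c r + d r)" for c d
    by (simp add: comb_def sum.distrib[symmetric] scalar_def single_add distrib_right)
  have ex_comb: "\<exists>c. \<pi> p = \<pi> (comb c)" if "p \<in> carrier F" for p
    using that
  proof (induction p rule: ncpoly_induct)
    case zero
    have "comb (\<lambda>_. 0) = 0" by (simp add: comb_def scalar_def)
    then show ?case by metis
  next
    case (add w a p)
    then have w: "set (letters w) \<subseteq> {..<n}" and p: "p \<in> carrier F"
      by (simp_all add: free_algebra_def keys_single_add)
    obtain r b where r: "r \<in> R" "\<pi> (monomial (letters w)) = b \<odot>\<^bsub>M\<^esub> \<pi> (monomial r)"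
      using span[OF w] by blast
    have mr: "monomial r \<in> carrier F" using r(1) R(2) by (intro monomial_in_free_algebra)
    obtain c where c: "\<pi> p = \<pi> (comb c)" using add.IH p by blast
    have "\<pi> (scalar a * monomial (letters w)) = a \<odot>\<^bsub>M\<^esub> (b \<odot>\<^bsub>M\<^esub> \<pi> (monomial r))"
      using w by (simp add: proj_smult[symmetric] monomial_in_free_algebra r(2))
    also have "\<dots> = \<pi> (scalar (a * b) * monomial r)"
      using mr by (simp add: proj_smult free_algebra_mult scalar_in_free_algebra
          mult.assoc[symmetric]) (simp add: scalar_def mult_single)
    also have "scalar (a * b) * monomial r = comb (\<lambda>r'. if r' = r then a * b else 0)"
    proof -
      have "comb (\<lambda>r'. if r' = r then a * b else 0) = (\<Sum>r' \<in> R. if r' = r then scalar (a * b) * monomial r else 0)"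
        unfolding comb_def by (rule sum.cong) (auto simp: scalar_def)
      then show ?thesis using r(1) R(1) by simp
    qed
    finally have "\<pi> (scalar a * monomial (letters w) + p) = \<pi> (comb (\<lambda>r'. if r' = r then a * b else 0) + comb c)"
      using c w p by (simp add: proj_add[symmetric] comb_closed free_algebra_mult scalar_in_free_algebra monomial_in_free_algebra)
    then show ?case unfolding single_eq_monomial comb_add by blast
  qed
  have ann_I: "lin (\<phi> r) p = 0" if "r \<in> R" "p \<in> Idl\<^bsub>F\<^esub> S" for r p
  proof -
    have "annihilates (\<phi> r) p"
      using S ann[OF that(1)] that(2) by (rule annihilates_genideal)
    then have "lin (\<phi> r) (monomial [] * p * monomial []) = 0" unfolding annihilates_def by blast
    moreover have "monomial [] = (1 :: 'r ncpoly)" by (simp add: monomial_def zero_word_def[symmetric])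
    ultimately show ?thesis by simp
  qed
  have lin_comb: "lin (\<phi> r) (comb c) = c r * \<phi> r r" if "r \<in> R" for r c
  proof -
    have "lin (\<phi> r) (comb c) = (\<Sum>r' \<in> R. if r' = r then c r * \<phi> r r else 0)"
      unfolding comb_def lin_sum using that by (intro sum.cong) (auto simp: lin_scalar off)
    then show ?thesis using that R(1) by simp
  qed
  have comb_inj: "c r = d r" if "\<pi> (comb c) = \<pi> (comb d)" "r \<in> R" for c d r
  proof -
    have "comb c - comb d \<in> Idl\<^bsub>F\<^esub> S"
      using that(1) by (simp add: proj_eq_iff comb_closed)
    then have "c r * \<phi> r r = d r * \<phi> r r"
      using ann_I[OF that(2), of "comb c - comb d"] that(2) by (simp add: lin_diff lin_comb)
    moreover obtain b where b: "1 = \<phi> r r * b" using unit[OF \<open>r \<in> R\<close>] by (rule dvdE)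
    ultimately have "c r * \<phi> r r * b = d r * \<phi> r r * b" by (simp only:)
    then show ?thesis unfolding mult.assoc b[symmetric] by simp
  qed
  have inj: "inj_on (\<lambda>r. \<pi> (monomial r)) R"
  proof
    fix r r' assume r: "r \<in> R" "r' \<in> R" "\<pi> (monomial r) = \<pi> (monomial r')"
    have "monomial r - monomial r' \<in> Idl\<^bsub>F\<^esub> S"
      using r R(2) by (simp add: proj_eq_iff[symmetric] monomial_in_free_algebra)
    then have "\<phi> r r = \<phi> r r'"
      using ann_I[OF r(1), of "monomial r - monomial r'"] by (simp add: lin_diff)
    moreover have "\<phi> r r \<noteq> 0" using unit[OF r(1)] by auto
    ultimately show "r = r'" using off r(1,2) by metis
  qed
  define B where "B = (\<lambda>r. \<pi> (monomial r)) ` R"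
  have B: "B \<subseteq> carrier M" using R(2) by (auto simp: B_def intro!: proj_closed monomial_in_free_algebra)
  have finsum_B: "(\<Oplus>\<^bsub>M\<^esub>b\<in>B. c b \<odot>\<^bsub>M\<^esub> b) = \<pi> (comb (\<lambda>r. c (\<pi> (monomial r))))" for c
  proof -
    have "(\<lambda>b. c b \<odot>\<^bsub>M\<^esub> b) \<in> B \<rightarrow> carrier M" using B by (auto simp: L)
    then show ?thesis
      unfolding B_def comb using inj by (intro M.finsum_reindex)
  qed
  have "\<exists>!c. c \<in> B \<rightarrow>\<^sub>E carrier ?L \<and> x = (\<Oplus>\<^bsub>M\<^esub>b\<in>B. c b \<odot>\<^bsub>M\<^esub> b)" if "x \<in> carrier M" for x
  proof (rule ex_ex1I)
    obtain p where p: "p \<in> carrier F" "x = \<pi> p" using proj_surj \<open>x \<in> carrier M\<close> by blast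
    obtain c where c: "\<pi> p = \<pi> (comb c)" using ex_comb p(1) by blast
    \<comment> \<open>Coefficients indexed by words are transported to \<open>B\<close> through the
      inverse of the injection; \<open>restrict\<close> supplies the value \<open>undefined\<close>
      outside \<open>B\<close> that the extensional function space demands.\<close>
    let ?c = "restrict (\<lambda>b. c (the_inv_into R (\<lambda>r. \<pi> (monomial r)) b)) B"
    have "comb (\<lambda>r. ?c (\<pi> (monomial r))) = comb c"
      unfolding comb_def using the_inv_into_f_f[OF inj] by (intro sum.cong) (auto simp: B_def)
    then have "?c \<in> B \<rightarrow>\<^sub>E carrier ?L \<and> x = (\<Oplus>\<^bsub>M\<^esub>b\<in>B. ?c b \<odot>\<^bsub>M\<^esub> b)"
      using p c by (simp only: finsum_B) (simp add: L)
    then show "\<exists>c. c \<in> B \<rightarrow>\<^sub>E carrier ?L \<and> x = (\<Oplus>\<^bsub>M\<^esub>b\<in>B. c b \<odot>\<^bsub>M\<^esub> b)" by blast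
  next
    fix c d
    assume c: "c \<in> B \<rightarrow>\<^sub>E carrier ?L \<and> x = (\<Oplus>\<^bsub>M\<^esub>b\<in>B. c b \<odot>\<^bsub>M\<^esub> b)"
      and d: "d \<in> B \<rightarrow>\<^sub>E carrier ?L \<and> x = (\<Oplus>\<^bsub>M\<^esub>b\<in>B. d b \<odot>\<^bsub>M\<^esub> b)"
    then have "\<pi> (comb (\<lambda>r. c (\<pi> (monomial r)))) = \<pi> (comb (\<lambda>r. d (\<pi> (monomial r))))"
      by (simp add: finsum_B)
    from comb_inj[OF this] have "c b = d b" if "b \<in> B" for b using that by (auto simp: B_def)
    then show "c = d" using conjunct1[OF c] conjunct1[OF d] by (rule_tac PiE_ext)
  qed
  then have "finite_basis ?L M B"
    unfolding finite_basis_def using B R(1) by (simp add: B_def)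
  moreover have "card B = card R"
    unfolding B_def using inj by (rule card_image)
  ultimately show ?thesis
    unfolding free_module_of_rank_def using M.module_axioms by blast
qed

end

section \<open>Independence and the rank\<close>

text \<open>
  Each letter \<open>0\<close> contributes an extra factor \<open>\<delta>\<close>, because \<open>e\<^sub>0\<close> acts as \<open>\<delta>\<close> times a
  Temperley-Lieb generator.
\<close>

primrec expo :: "nat list \<Rightarrow> int" where
  "expo [] = 0"
| "expo (i # w) = expo w + loop i (diagram w) + (if i = 0 then 1 else 0)"

text \<open>The coefficient at \<open>\<tau>\<close> of the image of \<open>w\<close> under e_0
  \<mapsto> \<delta> E_0, e_i \<mapsto> E_i, refined by the flag for the letter 0.\<close>

definition coef :: "bool \<times> (int \<Rightarrow> int) \<Rightarrow> nat list \<Rightarrow> laurent" where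
  "coef \<tau> w = (if (0 \<in> set w, diagram w) = \<tau> then Poly_Mapping.single (expo w) 1 else 0)"

lemma matching_diagram: "matching (diagram w)"
  by (intro matching_foldr matching_idm)

text \<open>Suffixes suffice in the hypotheses: a prefix changes a diagram, and adds loops, in a way
  that depends on the diagram only, so equal diagrams and the gap \<open>k\<close> survive any
  prefix.\<close>

lemma annihilates_coef:
  assumes "0 \<in> set p \<longleftrightarrow> 0 \<in> set q" "\<And>v. diagram (p @ v) = diagram (q @ v)"
    and "\<And>v. expo (p @ v) = expo (q @ v) + k"
  shows "annihilates (coef \<tau>) (monomial p - scalar (Poly_Mapping.single k 1) * monomial q)"
  unfolding annihilates_def
proof (intro allI)
  fix u v
  have eq: "monomial u * (monomial p - scalar (Poly_Mapping.single k 1) * monomial q) * monomial v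
      = monomial (u @ p @ v) - scalar (Poly_Mapping.single k (1 :: int)) * monomial (u @ q @ v)"
    using scalar_central[of "Poly_Mapping.single k (1 :: int)" "monomial u"]
    by (simp add: right_diff_distrib left_diff_distrib mult.assoc[symmetric] monomial_mult[symmetric])
  have "diagram (u @ p @ v) = diagram (u @ q @ v) \<and> expo (u @ p @ v) = expo (u @ q @ v) + k"
    using assms(2)[of v] assms(3)[of v] by (induction u) auto
  then have "coef \<tau> (u @ p @ v) = Poly_Mapping.single k 1 * coef \<tau> (u @ q @ v)"
    using assms(1) by (simp add: coef_def mult_single add.commute)
  then show "lin (coef \<tau>) (monomial u * (monomial p - scalar (Poly_Mapping.single k 1) * monomial q) * monomial v) = 0"
    unfolding eq by (simp add: lin_diff lin_scalar)
qed

lemma scalar_1: "scalar 1 = 1"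
  by (simp add: scalar_def)

text \<open>The exponent \<open>k\<close> counts lost loops plus lost letters 0: both occur once in
  e_0^2, only a loop in e_i^2, only a letter 0 in e_0 e_1 e_0, and neither in the other
  relations.\<close>

lemma DTLB_relators_monomial:
  assumes "s \<in> DTLB_relators n"
  obtains p q k where "s = monomial p - scalar (Poly_Mapping.single k 1) * monomial q"
    "0 \<in> set p \<longleftrightarrow> 0 \<in> set q" "\<And>v. diagram (p @ v) = diagram (q @ v)"
    "\<And>v. expo (p @ v) = expo (q @ v) + k"
  using assms
proof cases
  case sq0
  show ?thesis
    by (rule that[of "[0, 0]" 2 "[0]"])
      (use sq0 in \<open>simp_all add: gen_eq_monomial monomial_mult \<delta>_def mult_single power2_eq_square
        cup_sq loop_sq matching_diagram\<close>)
next
  case (sq i)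
  show ?thesis
    by (rule that[of "[i, i]" 1 "[i]"])
      (use sq in \<open>simp_all add: gen_eq_monomial monomial_mult \<delta>_def cup_sq loop_sq matching_diagram\<close>)
next
  case (comm i j)
  then have ij: "Suc i < j \<or> Suc j < i" by linarith
  show ?thesis
  proof (rule that[of "[i, j]" 0 "[j, i]"])
    show "s = monomial [i, j] - scalar (Poly_Mapping.single 0 1) * monomial [j, i]"
      using comm by (simp add: gen_eq_monomial monomial_mult scalar_1)
    show "diagram ([i, j] @ v) = diagram ([j, i] @ v)" for v
      using ij cup_comm[OF matching_diagram] by auto
    show "expo ([i, j] @ v) = expo ([j, i] @ v) + 0" for v
      using ij loop_comm[OF matching_diagram, of i j v] loop_comm[OF matching_diagram, of j i v] by auto
  qed auto
next
  case (triple i j)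
  then have ij: "j = Suc i \<or> i = Suc j" by linarith
  show ?thesis
  proof (rule that[of "[i, j, i]" 0 "[i]"])
    show "s = monomial [i, j, i] - scalar (Poly_Mapping.single 0 1) * monomial [i]"
      using triple by (simp add: gen_eq_monomial monomial_mult scalar_1)
    show "diagram ([i, j, i] @ v) = diagram ([i] @ v)" for v
      using ij by (auto simp: cup_up cup_down matching_diagram)
    show "expo ([i, j, i] @ v) = expo ([i] @ v) + 0" for v
      using ij triple by (auto simp: loop_up loop_down matching_diagram matching_cup)
  qed (use triple in auto)
next
  case triple0
  show ?thesis
    by (rule that[of "[0, 1, 0]" 1 "[0]"])
      (use triple0 in \<open>simp_all add: gen_eq_monomial monomial_mult \<delta>_def cup_up[of _ 0, simplified]
        loop_up[of _ 0, simplified] loop_down[of _ 0, simplified] matching_cup matching_diagram\<close>)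
qed

text \<open>The palindrome i ... 1 0 1 ... i collapses from its centre by \<open>cup_down\<close>.
  Hence spelling out the z_i does not alter the diagram of a Jones word.\<close>

lemma foldr_cup_zletter: "matching \<mu> \<Longrightarrow> foldr cup (zletter i) \<mu> = cup i \<mu>"
  by (induction i arbitrary: \<mu>) (simp_all add: zletter_0 zletter_Suc matching_cup cup_down)

lemma diagram_zword: "diagram (zword w) = diagram w"
  by (induction w) (simp_all add: foldr_cup_zletter matching_diagram)

lemma inj_on_diagram_jword: "inj_on (\<lambda>bs. diagram (jword bs)) (jones_set m k t)"
  by (auto simp: jones_set_def intro!: inj_onI jones_diagram_inj)

lemma jword_eq_Nil: "jones bs \<Longrightarrow> jword bs = [] \<longleftrightarrow> bs = []"
  by (cases bs) auto

lemma zero_in_jword: "bs \<in> jones_set n 1 1 \<Longrightarrow> 0 \<notin> set (jword bs)"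
  by (auto simp: jones_set_def jword_def)

lemma zero_in_zword: "bs \<in> jones_set n 0 0 - {[]} \<Longrightarrow> 0 \<in> set (zword (jword bs))"
  using jword_eq_Nil[of bs] by (cases "jword bs") (auto simp: set_zword set_zletter jones_set_def)

lemma inj_on_invariant: "inj_on (\<lambda>w. (0 \<in> set w, diagram w)) (DTL_words n)"
proof (rule inj_onI)
  fix v w assume v: "v \<in> DTL_words n" and w: "w \<in> DTL_words n"
    and eq: "(0 \<in> set v, diagram v) = (0 \<in> set w, diagram w)"
  show "v = w"
  proof (cases "0 \<in> set v")
    case True
    with eq v w obtain bs cs where "v = zword (jword bs)" "w = zword (jword cs)"
      "bs \<in> jones_set n 0 0" "cs \<in> jones_set n 0 0"
      using zero_in_jword by (auto simp: DTL_words_def)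
    with eq show ?thesis
      using inj_onD[OF inj_on_diagram_jword[of n 0 0], of bs cs] by (simp add: diagram_zword)
  next
    case False
    with eq v w obtain bs cs where "v = jword bs" "w = jword cs"
      "bs \<in> jones_set n 1 1" "cs \<in> jones_set n 1 1"
      using zero_in_zword by (auto simp: DTL_words_def)
    with eq show ?thesis
      using inj_onD[OF inj_on_diagram_jword[of n 1 1], of bs cs] by simp
  qed
qed

lemma finite_DTL_words: "finite (DTL_words n)"
  by (simp add: DTL_words_def finite_jones_set)

lemma card_DTL_words:
  assumes "1 \<le> n"
  shows "card (DTL_words n) = catalan n + catalan (n + 1) - 1"
proof -
  let ?A = "jword ` jones_set n 1 1" and ?B = "(\<lambda>bs. zword (jword bs)) ` (jones_set n 0 0 - {[]})"
  have "?A \<inter> ?B = {}" using zero_in_jword zero_in_zword by fastforce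
  then have "card (DTL_words n) = card ?A + card ?B"
    unfolding DTL_words_def by (intro card_Un_disjoint) (simp_all add: finite_jones_set)
  also have "card ?A = card (jones_set n 1 1)"
    using inj_on_diagram_jword[of n 1 1] by (intro card_image) (auto simp: inj_on_def)
  also have "\<dots> = catalan n"
    using card_jones_set[of 1 "n - 1"] assms by simp
  also have "card ?B = card (jones_set n 0 0 - {[]})"
    using inj_on_diagram_jword[of n 0 0]
    by (intro card_image) (auto simp: inj_on_def, metis diagram_zword)
  also have "\<dots> = catalan (n + 1) - 1"
    using card_jones_set[of 0 n] by (simp add: finite_jones_set)
  \<comment> \<open>The truncated subtraction may be moved outward because the empty list makes the
    second Catalan number positive.\<close>
  finally show ?thesis
    using card_jones_set[of 0 n] finite_jones_set[of n 0 0] card_gt_0_iff[of "jones_set n 0 0"]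
    by (metis Nat.add_diff_assoc One_nat_def Suc_eq_plus1 Suc_leI add_0 empty_iff Nil_in_jones_set)
qed

lemma set_DTL_words: "w \<in> DTL_words n \<Longrightarrow> set w \<subseteq> {..<n}"
  by (fastforce simp: DTL_words_def set_zword jword_def jones_set_def)

section \<open>The presented algebra as an instance of the abstract action\<close>

context
  fixes n :: nat
begin

private abbreviation "FA \<equiv> free_algebra n :: laurent ncpoly ring"
private abbreviation "MA \<equiv> presented_algebra n (DTLB_relators n)"
private abbreviation "\<rho> \<equiv> proj n (DTLB_relators n)"

text \<open>Like \<open>DTLB_gen\<close>, this is the identity outside the carrier, because the laws
  of \<open>DTL_action\<close> are required at every element of the type.\<close>

definition DTLB_shift :: "int \<Rightarrow> laurent ncpoly set \<Rightarrow> laurent ncpoly set" where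
  "DTLB_shift k x = (if x \<in> carrier MA then Poly_Mapping.single k 1 \<odot>\<^bsub>MA\<^esub> x else x)"

definition DTLB_gen :: "nat \<Rightarrow> laurent ncpoly set \<Rightarrow> laurent ncpoly set" where
  "DTLB_gen i x = (if x \<in> carrier MA then \<rho> (gen i) \<otimes>\<^bsub>MA\<^esub> x else x)"

lemma DTLB_shift_proj: "p \<in> carrier FA \<Longrightarrow> DTLB_shift k (\<rho> p) = \<rho> (scalar (Poly_Mapping.single k 1) * p)"
  by (simp add: DTLB_shift_def DTLB_relators_subset proj_closed proj_smult)

lemma DTLB_gen_proj: "i < n \<Longrightarrow> p \<in> carrier FA \<Longrightarrow> DTLB_gen i (\<rho> p) = \<rho> (gen i * p)"
  by (simp add: DTLB_gen_def DTLB_relators_subset proj_closed proj_mult gen_in_free_algebra)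

lemma DTLB_induct:
  assumes "\<And>p. p \<in> carrier FA \<Longrightarrow> P (\<rho> p)" "\<And>x. x \<notin> carrier MA \<Longrightarrow> P x"
  shows "P x"
  using assms proj_surj[OF DTLB_relators_subset] by metis

lemma DTLB_relation:
  assumes "p - q \<in> DTLB_relators n" "p \<in> carrier FA" "q \<in> carrier FA" "r \<in> carrier FA"
  shows "\<rho> (p * r) = \<rho> (q * r)"
  using DTLB_relators_subset assms by (rule proj_eqI)

lemma DTL_action_DTLB: "DTL_action DTLB_shift DTLB_gen n"
proof
  have out: "DTLB_shift k x = x" "DTLB_gen i x = x" if "x \<notin> carrier MA" for k i x
    using that by (simp_all add: DTLB_shift_def DTLB_gen_def)
  note simps = DTLB_shift_proj DTLB_gen_proj free_algebra_mult gen_in_free_algebra scalar_in_free_algebra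
  have sc: "scalar a * scalar b = scalar (a * b)" for a b :: laurent
    by (simp add: scalar_def mult_single)
  fix x k l i j
  show "DTLB_shift 0 x = x"
    by (induction x rule: DTLB_induct) (simp_all add: out simps scalar_1)
  show "DTLB_shift k (DTLB_shift l x) = DTLB_shift (k + l) x"
    by (induction x rule: DTLB_induct)
      (simp_all add: out simps mult.assoc[symmetric] sc mult_single)
  show "DTLB_gen i (DTLB_shift k x) = DTLB_shift k (DTLB_gen i x)" if "i \<in> {..<n}"
    using that scalar_central[of "Poly_Mapping.single k (1 :: int)" "gen i"]
    by (induction x rule: DTLB_induct) (simp_all add: out simps mult.assoc[symmetric])
  show "DTLB_gen 0 (DTLB_gen 0 x) = DTLB_shift 2 (DTLB_gen 0 x)" if "0 < n"
    using that DTLB_relation[OF DTLB_relators.sq0]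
    by (induction x rule: DTLB_induct)
      (simp_all add: out simps mult.assoc[symmetric] \<delta>_def mult_single power2_eq_square)
  show "DTLB_gen i (DTLB_gen i x) = DTLB_shift 1 (DTLB_gen i x)" if "1 \<le> i" "i < n"
    using that DTLB_relation[OF DTLB_relators.sq]
    by (induction x rule: DTLB_induct) (simp_all add: out simps mult.assoc[symmetric] \<delta>_def)
  show "DTLB_gen i (DTLB_gen j x) = DTLB_gen j (DTLB_gen i x)" if "Suc i < j" "j < n"
    using that DTLB_relation[OF DTLB_relators.comm[of i n j]]
    by (induction x rule: DTLB_induct) (simp_all add: out simps mult.assoc[symmetric])
  show "DTLB_gen i (DTLB_gen (Suc i) (DTLB_gen i x)) = DTLB_gen i x" if "1 \<le> i" "Suc i < n"
    using that DTLB_relation[OF DTLB_relators.triple[of i n "Suc i"]]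
    by (induction x rule: DTLB_induct) (simp_all add: out simps mult.assoc[symmetric])
  show "DTLB_gen (Suc i) (DTLB_gen i (DTLB_gen (Suc i) x)) = DTLB_gen (Suc i) x" if "1 \<le> i" "Suc i < n"
    using that DTLB_relation[OF DTLB_relators.triple[of "Suc i" n i]]
    by (induction x rule: DTLB_induct) (simp_all add: out simps mult.assoc[symmetric])
  show "DTLB_gen 0 (DTLB_gen 1 (DTLB_gen 0 x)) = DTLB_shift 1 (DTLB_gen 0 x)" if "1 < n"
    using that DTLB_relation[OF DTLB_relators.triple0]
    by (induction x rule: DTLB_induct) (simp_all add: out simps mult.assoc[symmetric] \<delta>_def)
qed

lemma foldr_DTLB_gen: "set w \<subseteq> {..<n} \<Longrightarrow> foldr DTLB_gen w (\<rho> (monomial [])) = \<rho> (monomial w)"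
  by (induction w) (simp_all add: DTLB_gen_proj monomial_in_free_algebra gen_eq_monomial monomial_mult)

lemma DTLB_span:
  assumes "set w \<subseteq> {..<n}"
  shows "\<exists>r \<in> DTL_words n. \<exists>a. \<rho> (monomial w) = a \<odot>\<^bsub>MA\<^esub> \<rho> (monomial r)"
proof -
  \<comment> \<open>The operator identity is evaluated at the class of the empty word, the unit,
    where the operator of a word yields the class of that word.\<close>
  obtain k r where r: "r \<in> DTL_words n"
    "foldr DTLB_gen w (\<rho> (monomial [])) = DTLB_shift k (foldr DTLB_gen r (\<rho> (monomial [])))"
    using DTL_action.foldr_eq_DTL_word[OF DTL_action_DTLB assms] by blast
  then have "\<rho> (monomial w) = DTLB_shift k (\<rho> (monomial r))"
    using assms by (simp add: foldr_DTLB_gen set_DTL_words)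
  also have "\<dots> = Poly_Mapping.single k 1 \<odot>\<^bsub>MA\<^esub> \<rho> (monomial r)"
    using set_DTL_words[OF r(1)]
    by (simp add: DTLB_shift_def proj_closed DTLB_relators_subset monomial_in_free_algebra)
  finally show ?thesis using r(1) by blast
qed

end

theorem theorem8p2:
  fixes n :: nat
  assumes "n \<ge> 1"
  shows "free_module_of_rank (ring_of_type_algebra :: laurent ring) (DTLB n)
           (catalan n + catalan (n + 1) - 1)"
  unfolding card_DTL_words[OF assms, symmetric] DTLB_def
proof (rule free_module_presented[OF DTLB_relators_subset finite_DTL_words set_DTL_words DTLB_span])
  let ?\<phi> = "\<lambda>r. coef (0 \<in> set r, diagram r)"
  show "annihilates (?\<phi> r) s" if "s \<in> DTLB_relators n" for r s
    using DTLB_relators_monomial[OF that] annihilates_coef by metis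
  show "?\<phi> r r' = 0" if "r \<in> DTL_words n" "r' \<in> DTL_words n" "r \<noteq> r'" for r r'
  proof -
    have "(0 \<in> set r', diagram r') \<noteq> (0 \<in> set r, diagram r)"
      using inj_onD[OF inj_on_invariant, of r' r] that by blast
    then show ?thesis by (simp only: coef_def if_False)
  qed
  show "?\<phi> r r dvd 1" for r
  proof -
    have "1 = ?\<phi> r r * Poly_Mapping.single (- expo r) 1" by (simp add: coef_def mult_single)
    then show ?thesis by (rule dvdI)
  qed
qed

end
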